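(* The property $\mathcal{P}_{\mathrm{NLTF}}$ is testable (with one-sided error), but any non-adaptive one-sided-error tester for $\mathcal{P}_{\mathrm{NLTF}}$ requires $\omega(1/\epsilon)$ queries.
   Context: Functions are $f:\mathbb{F}_2^n\to\{0,1\}$. $f$ is linear if $f(x)+f(y)=f(x+y)$ (mod 2) for all $x,y$; $\mathcal{P}_{\mathrm{LIN}}$ is the set of linear functions. $f$ is triangle-free if for all $x,y$, $(f(x),f(y),f(x+y))\neq(1,1,1)$; $\mathcal{P}_{(111)\text{-FREE}}$ is the set of such functions; $\mathcal{P}_{\mathrm{NLTF}}=\mathcal{P}_{(111)\text{-FREE}}\setminus\mathcal{P}_{\mathrm{LIN}}$. $\mathrm{dist}(f,g)=\Pr_x[f(x)\neq g(x)]$ for uniform $x$ and $\mathrm{dist}(f,\mathcal{P})=\min_{g\in\mathcal{P}}\mathrm{dist}(f,g)$. A (one-sided error) tester for $\mathcal{P}$ with distance parameter $\epsilon$ queries $f$, accepts with probability $1$ if $f\in\mathcal{P}$, and accepts with probability at most $1/3$ if $\mathrm{dist}(f,\mathcal{P})\geq\epsilon$; $\mathcal{P}$ is testable if such a tester exists with number of queries depending only on $\epsilon$. A tester is non-adaptive if all its query points are determined before any answers are received. *)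

theory Defs
  imports
    "HOL-Library.Z2"
    "HOL-Library.FuncSet"
    "HOL-Library.Landau_Symbols"
    "HOL-Probability.Probability_Mass_Function"
    "Jordan_Normal_Form.Matrix"
begin

text \<open>
  The space \<open>F\<^sub>2\<^sup>n\<close>, for a variable dimension \<open>n\<close>, is \<^term>\<open>carrier_vec n :: bit vec set\<close>.
  Since the type \<^typ>\<open>bit vec\<close> contains vectors of all dimensions, Boolean functions on
  \<open>F\<^sub>2\<^sup>n\<close> are taken to be \<^const>\<open>undefined\<close> outside of the carrier.
\<close>

type_synonym boolfun = "bit vec \<Rightarrow> bit"

definition boolfuns :: "nat \<Rightarrow> boolfun set" where
  "boolfuns n = carrier_vec n \<rightarrow>\<^sub>E UNIV"

text \<open>A property is a set of Boolean functions for every dimension.\<close>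

type_synonym property = "nat \<Rightarrow> boolfun set"

definition LIN :: property where
  "LIN n = {f \<in> boolfuns n. \<forall>x\<in>carrier_vec n. \<forall>y\<in>carrier_vec n. f x + f y = f (x + y)}"

definition triangle_free :: property where
  "triangle_free n = {f \<in> boolfuns n.
     \<forall>x\<in>carrier_vec n. \<forall>y\<in>carrier_vec n. (f x, f y, f (x + y)) \<noteq> (1, 1, 1)}"

definition NLTF :: property where
  "NLTF n = triangle_free n - LIN n"

definition fun_dist :: "nat \<Rightarrow> boolfun \<Rightarrow> boolfun \<Rightarrow> real" where
  "fun_dist n f g = measure_pmf.prob (pmf_of_set (carrier_vec n)) {x. f x \<noteq> g x}"

text \<open>
  The infimum is a minimum whenever the property is nonempty in dimension \<open>n\<close>
  (see \<open>property_dist_eq_Min\<close> below). The extended reals give distance \<open>\<infinity>\<close> to the empty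
  set; \<^term>\<open>NLTF n\<close> is empty for \<^prop>\<open>n \<le> 1\<close>.
\<close>

definition property_dist :: "nat \<Rightarrow> boolfun \<Rightarrow> boolfun set \<Rightarrow> ereal" where
  "property_dist n f P = (INF g\<in>P. ereal (fun_dist n f g))"

text \<open>
  A deterministic (in general adaptive) query algorithm is a decision tree: it either halts,
  accepting or rejecting, or queries a point and continues depending on the answer.
  A randomized one is a probability distribution on decision trees. All random coins,
  including those used after some answers have been received, are drawn at the outset.
\<close>

datatype query_tree = Halt bool | Query "bit vec" "bit \<Rightarrow> query_tree"

primrec accepts :: "query_tree \<Rightarrow> boolfun \<Rightarrow> bool" where
  "accepts (Halt b) f = b"
| "accepts (Query x t) f = accepts (t (f x)) f"

primrec queries :: "query_tree \<Rightarrow> boolfun \<Rightarrow> bit vec list" where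
  "queries (Halt b) f = []"
| "queries (Query x t) f = x # queries (t (f x)) f"

definition accept_prob :: "query_tree pmf \<Rightarrow> boolfun \<Rightarrow> real" where
  "accept_prob T f = measure_pmf.prob T {t. accepts t f}"

definition one_sided_tester :: "property \<Rightarrow> nat \<Rightarrow> real \<Rightarrow> query_tree pmf \<Rightarrow> bool" where
  "one_sided_tester P n \<epsilon> T \<longleftrightarrow>
     (\<forall>t\<in>set_pmf T. \<forall>f\<in>boolfuns n. set (queries t f) \<subseteq> carrier_vec n) \<and>
     (\<forall>f\<in>P n. accept_prob T f = 1) \<and>
     (\<forall>f\<in>boolfuns n. property_dist n f (P n) \<ge> ereal \<epsilon> \<longrightarrow> accept_prob T f \<le> 1 / 3)"

definition max_queries :: "nat \<Rightarrow> query_tree pmf \<Rightarrow> nat \<Rightarrow> bool" where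
  "max_queries n T q \<longleftrightarrow> (\<forall>t\<in>set_pmf T. \<forall>f\<in>boolfuns n. length (queries t f) \<le> q)"

text \<open>For each outcome of the coins, the query points do not depend on the function queried.\<close>

definition nonadaptive :: "nat \<Rightarrow> query_tree pmf \<Rightarrow> bool" where
  "nonadaptive n T \<longleftrightarrow> (\<forall>t\<in>set_pmf T. \<exists>xs. \<forall>f\<in>boolfuns n. queries t f = xs)"

text \<open>
  A family \<open>T \<epsilon> n\<close> of one-sided error testers for all distance parameters and all dimensions,
  whose number of queries is bounded by \<open>q \<epsilon>\<close>, independently of the dimension.
\<close>

definition one_sided_tester_family ::
  "property \<Rightarrow> (real \<Rightarrow> nat \<Rightarrow> query_tree pmf) \<Rightarrow> (real \<Rightarrow> nat) \<Rightarrow> bool" where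
  "one_sided_tester_family P T q \<longleftrightarrow>
     (\<forall>\<epsilon>>0. \<forall>n. one_sided_tester P n \<epsilon> (T \<epsilon> n) \<and> max_queries n (T \<epsilon> n) (q \<epsilon>))"

definition one_sided_testable :: "property \<Rightarrow> bool" where
  "one_sided_testable P \<longleftrightarrow> (\<exists>T q. one_sided_tester_family P T q)"

lemma UNIV_bit: "(UNIV :: bit set) = {0, 1}"
  using bit_not_one_iff by blast

lemma finite_carrier_vec_bit: "finite (carrier_vec n :: bit vec set)"
proof -
  have "finite (UNIV :: bit set)"
    by (simp add: UNIV_bit)
  then have fin: "finite (vec n ` ({..<n} \<rightarrow>\<^sub>E (UNIV :: bit set)))"
    by (intro finite_imageI finite_PiE) simp_all
  have "v \<in> vec n ` ({..<n} \<rightarrow>\<^sub>E UNIV)" if "v \<in> carrier_vec n" for v :: "bit vec"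
  proof (rule image_eqI)
    show "v = vec n (restrict (vec_index v) {..<n})"
      using that by (intro eq_vecI) simp_all
    show "restrict (vec_index v) {..<n} \<in> {..<n} \<rightarrow>\<^sub>E UNIV"
      by simp
  qed
  then have "(carrier_vec n :: bit vec set) \<subseteq> vec n ` ({..<n} \<rightarrow>\<^sub>E UNIV)"
    by (rule subsetI)
  then show ?thesis
    using fin by (rule finite_subset)
qed

lemma finite_boolfuns: "finite (boolfuns n)"
  unfolding boolfuns_def
  by (intro finite_PiE finite_carrier_vec_bit) (simp add: UNIV_bit)

lemma fun_dist_eq_card:
  "fun_dist n f g = card {x \<in> carrier_vec n. f x \<noteq> g x} / card (carrier_vec n :: bit vec set)"
proof -
  have "(carrier_vec n :: bit vec set) \<noteq> {}"
    using zero_carrier_vec by blast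
  then show ?thesis
    unfolding fun_dist_def
    by (simp add: measure_pmf_of_set finite_carrier_vec_bit Int_def)
qed

lemma property_dist_eq_Min:
  assumes "P \<subseteq> boolfuns n" "P \<noteq> {}"
  shows "property_dist n f P = ereal (Min (fun_dist n f ` P))"
proof -
  have fin: "finite P"
    using assms finite_boolfuns finite_subset by blast
  have "property_dist n f P = Min ((\<lambda>g. ereal (fun_dist n f g)) ` P)"
    unfolding property_dist_def using fin assms(2) by (intro cInf_eq_Min) simp_all
  also have "\<dots> = ereal (Min (fun_dist n f ` P))"
    using mono_Min_commute[of ereal "fun_dist n f ` P"] fin assms(2)
    unfolding image_image by (simp add: mono_def)
  finally show ?thesis .
qed

end

theory Submission
  imports Defs
begin

text \<open>
  In dimension at least 2 every triangle-free function is within one point of \<open>NLTF\<close>: a linear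
  function loses linearity, but not triangle-freeness, when one point is removed from its support or,
  for the zero function, one nonzero point is added. So for \<open>2 / 2 ^ n < \<epsilon>\<close> it suffices to test
  triangle-freeness by sampling random triples, which works by Green's arithmetic removal lemma; in
  the remaining dimensions one queries everything.
  The removal lemma is proved by an energy increment over the partitions of the cube into the level
  sets of finitely many characters.

  For the lower bound, the set of \<open>c \<in> (F\<^sub>2\<^sup>2)\<^sup>t\<close> with all blocks nonzero has density \<open>(3/4)\<^sup>t\<close>
  and triangle density \<open>(3/8)\<^sup>t\<close>, and all its points lie in equally many triangles, so that
  one third of it has to be removed to destroy all triangles. Its preimage under a random linear map is
  as far from triangle-free, while every fixed pair of distinct nonzero points lies in a triangle of the
  preimage with probability \<open>(3/8)\<^sup>t\<close>. A one-sided tester can reject only if it sees a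
  triangle, so \<open>q\<^sup>2 (3/8)\<^sup>t \<ge> 1/3\<close>, whereas \<open>1/\<epsilon>\<close> is of order \<open>(4/3)\<^sup>t\<close> and
  \<open>(4/3)\<^sup>2 < 8/3\<close>.
\<close>

section \<open>Conditional expectations and energy increment\<close>

text \<open>Cutting the cube by characters gives cells that are cosets of one subspace: the sum of
  two cells is a cell, and all cells have the same size, so triangles can be counted cell by cell.
  For the lower bound a single hard function would not do, since a tester that knows it can query
  one of its triangles. A random linear map destroys this knowledge: two distinct nonzero points
  have independent uniform images. Non-adaptivity fixes the points before the map is drawn, which
  permits a union bound over at most q^2 pairs. Pairs containing 0 or a repeated point are harmless,
  because every hard function vanishes at 0. The densities come from F_2^2: 3 of its 4 elements are
  nonzero, and 6 of its 16 ordered pairs consist of distinct nonzero elements, whose sum is then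
  nonzero too. The map is drawn among all families of rows, because only then are the rows
  independent random vectors. Distance needs the map to be onto, that is, linearly independent rows;
  in large dimension at least half of the families have them.\<close>

definition cavg :: "'a set \<Rightarrow> ('a \<Rightarrow> 'k) \<Rightarrow> ('a \<Rightarrow> real) \<Rightarrow> 'a \<Rightarrow> real" where
  "cavg V k f x = (\<Sum>y\<in>{y\<in>V. k y = k x}. f y) / card {y\<in>V. k y = k x}"

lemma cavg_cong: "k x = k y \<Longrightarrow> cavg V k f x = cavg V k f y"
  by (simp add: cavg_def)

text \<open>Conditional expectation onto the fibres of \<open>k\<close> is self-adjoint and fixes
  the fibre-constant function \<open>h\<close>. Written out, the claim is a sum over pairs of points
  in a common fibre, taken in the two orders.\<close>

lemma sum_cavg:
  assumes "finite V" and h: "\<And>x y. x \<in> V \<Longrightarrow> y \<in> V \<Longrightarrow> k x = k y \<Longrightarrow> h x = h y"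
  shows "(\<Sum>x\<in>V. cavg V k f x * h x) = (\<Sum>x\<in>V. f x * h x)"
proof -
  let ?c = "\<lambda>x. real (card {y\<in>V. k y = k x})"
  have "(\<Sum>x\<in>V. cavg V k f x * h x) = (\<Sum>x\<in>V. \<Sum>y\<in>{y\<in>V. k y = k x}. f y * h x / ?c x)"
    by (simp only: cavg_def sum_divide_distrib sum_distrib_right times_divide_eq_left)
  also have "\<dots> = (\<Sum>x\<in>V. \<Sum>y\<in>{y\<in>V. k y = k x}. f y * h y / ?c y)"
  proof (intro sum.cong refl)
    fix x y assume "x \<in> V" "y \<in> {y\<in>V. k y = k x}"
    then have "h x = h y" and "k y = k x"
      using h[of x y] by auto
    then show "f y * h x / ?c x = f y * h y / ?c y"
      by simp
  qed
  also have "\<dots> = (\<Sum>y\<in>V. \<Sum>x\<in>{x\<in>V. k x = k y}. f y * h y / ?c y)"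
    by (subst sum.swap_restrict[OF assms(1,1)]) (intro sum.cong refl, auto)
  also have "\<dots> = (\<Sum>y\<in>V. f y * h y)"
  proof (intro sum.cong refl)
    fix y assume "y \<in> V"
    then have "?c y \<noteq> 0"
      using assms(1) by auto
    then show "(\<Sum>x\<in>{x\<in>V. k x = k y}. f y * h y / ?c y) = f y * h y"
      by simp
  qed
  finally show ?thesis .
qed

lemma cavg_mono:
  assumes "\<And>y. y \<in> V \<Longrightarrow> k y = k x \<Longrightarrow> f y \<le> g y"
  shows "cavg V k f x \<le> cavg V k g x"
  unfolding cavg_def using assms by (intro divide_right_mono sum_mono) auto

lemma cavg_const:
  assumes "finite V" "x \<in> V"
  shows "cavg V k (\<lambda>_. c) x = c"
proof -
  have "card {y\<in>V. k y = k x} \<noteq> 0"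
    using assms by auto
  then show ?thesis
    by (simp add: cavg_def)
qed

text \<open>The coarse average is constant on the fibres of the finer labelling \<open>k'\<close>,
  so by \<open>sum_cavg\<close> the mixed term equals the coarse energy: the increment is orthogonal
  to the coarse average.\<close>

lemma cavg_pythagoras:
  assumes "finite V"
    and refines: "\<And>x y. x \<in> V \<Longrightarrow> y \<in> V \<Longrightarrow> k' x = k' y \<Longrightarrow> k x = k y"
  shows "(\<Sum>x\<in>V. (cavg V k' f x - cavg V k f x)\<^sup>2)
    = (\<Sum>x\<in>V. (cavg V k' f x)\<^sup>2) - (\<Sum>x\<in>V. (cavg V k f x)\<^sup>2)"
proof -
  have 1: "(\<Sum>x\<in>V. cavg V k' f x * cavg V k f x) = (\<Sum>x\<in>V. f x * cavg V k f x)"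
    by (rule sum_cavg[OF assms(1)]) (rule cavg_cong, rule refines)
  have 2: "(\<Sum>x\<in>V. cavg V k f x * cavg V k f x) = (\<Sum>x\<in>V. f x * cavg V k f x)"
    by (rule sum_cavg[OF assms(1)]) (rule cavg_cong)
  have "(\<Sum>x\<in>V. (cavg V k' f x - cavg V k f x)\<^sup>2)
    = (\<Sum>x\<in>V. (cavg V k' f x)\<^sup>2) + (\<Sum>x\<in>V. cavg V k f x * cavg V k f x)
      - 2 * (\<Sum>x\<in>V. cavg V k' f x * cavg V k f x)"
    by (simp add: power2_eq_square algebra_simps sum.distrib sum_subtractf sum_distrib_left)
  then show ?thesis
    using 1 2 by (simp add: power2_eq_square)
qed

text \<open>\<open>D\<close> is a union of cells of \<open>k'\<close>, so \<open>f\<close> and its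
  finer average have the same sum over it, and the deviation on \<open>D\<close> survives averaging.
  Cauchy-Schwarz against the indicator of \<open>D\<close> turns it into a mean square of at least
  \<open>\<eta>\<^sup>2\<close> over the cell of \<open>k\<close>.\<close>

lemma energy_increment:
  fixes \<eta> :: real
  assumes "finite V" "\<eta> \<ge> 0"
    and refines: "\<And>x y. x \<in> V \<Longrightarrow> y \<in> V \<Longrightarrow> k' x = k' y \<Longrightarrow> k x = k y"
    and Bad: "Bad \<subseteq> V" "\<And>x y. x \<in> Bad \<Longrightarrow> y \<in> V \<Longrightarrow> k x = k y \<Longrightarrow> y \<in> Bad"
    and D: "\<And>x. x \<in> Bad \<Longrightarrow> \<exists>D\<subseteq>{y\<in>V. k y = k x}.
      (\<forall>y\<in>D. \<forall>z\<in>V. k' y = k' z \<longrightarrow> z \<in> D) \<and>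
      \<bar>\<Sum>y\<in>D. f y - cavg V k f y\<bar> \<ge> \<eta> * card {y\<in>V. k y = k x}"
  shows "(\<Sum>x\<in>V. (cavg V k' f x)\<^sup>2) \<ge> (\<Sum>x\<in>V. (cavg V k f x)\<^sup>2) + \<eta>\<^sup>2 * card Bad"
proof -
  let ?g = "\<lambda>x. cavg V k' f x - cavg V k f x"
  have loc: "\<eta>\<^sup>2 \<le> cavg V k (\<lambda>y. (?g y)\<^sup>2) x" if x: "x \<in> Bad" for x
  proof -
    let ?C = "{y\<in>V. k y = k x}"
    obtain D where DC: "D \<subseteq> ?C" and cl: "\<And>y z. y \<in> D \<Longrightarrow> z \<in> V \<Longrightarrow> k' y = k' z \<Longrightarrow> z \<in> D"
      and big: "\<bar>\<Sum>y\<in>D. f y - cavg V k f y\<bar> \<ge> \<eta> * card ?C"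
      using D[OF x] by blast
    have fC: "finite ?C"
      using assms(1) by simp
    have [simp]: "finite D"
      using DC fC by (rule finite_subset)
    have DV: "V \<inter> D = D"
      using DC by auto
    let ?i = "\<lambda>x. if x \<in> D then 1 else 0 :: real"
    have "(\<Sum>y\<in>V. cavg V k' f y * ?i y) = (\<Sum>y\<in>V. f y * ?i y)"
      by (rule sum_cavg[OF assms(1)]) (use cl in metis)
    then have "(\<Sum>y\<in>D. cavg V k' f y) = (\<Sum>y\<in>D. f y)"
      using assms(1) DV by (simp add: if_distrib sum.If_cases cong: if_cong)
    then have gD: "\<bar>\<Sum>y\<in>D. ?g y\<bar> \<ge> \<eta> * card ?C"
      using big by (simp add: sum_subtractf)
    have "x \<in> ?C"
      using x Bad by auto
    then have c0: "card ?C > 0"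
      using fC card_gt_0_iff by blast
    have "(\<eta> * card ?C)\<^sup>2 \<le> (\<Sum>y\<in>D. ?g y)\<^sup>2"
      using gD assms(2) power_mono[OF gD, of 2] by simp
    also have "\<dots> \<le> (\<Sum>y\<in>D. 1\<^sup>2) * (\<Sum>y\<in>D. (?g y)\<^sup>2)"
      using Cauchy_Schwarz_ineq_sum[of "\<lambda>_. 1" ?g D] by simp
    also have "\<dots> \<le> card ?C * (\<Sum>y\<in>?C. (?g y)\<^sup>2)"
      using DC fC by (intro mult_mono sum_mono2) (auto intro: card_mono sum_nonneg)
    finally have "card ?C * (\<eta>\<^sup>2 * card ?C) \<le> card ?C * (\<Sum>y\<in>?C. (?g y)\<^sup>2)"
      by (simp only: power2_eq_square mult_ac)
    then have "\<eta>\<^sup>2 * card ?C \<le> (\<Sum>y\<in>?C. (?g y)\<^sup>2)"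
      by (rule mult_left_le_imp_le) (use c0 in simp)
    then show ?thesis
      using c0 unfolding cavg_def[of V k "\<lambda>y. (?g y)\<^sup>2"] by (subst pos_le_divide_eq) auto
  qed
  have "\<eta>\<^sup>2 * card Bad = (\<Sum>x\<in>Bad. \<eta>\<^sup>2)"
    by simp
  also have "\<dots> \<le> (\<Sum>x\<in>Bad. cavg V k (\<lambda>y. (?g y)\<^sup>2) x)"
    by (intro sum_mono loc)
  \<comment> \<open>Membership in \<open>Bad\<close> is constant on the cells of \<open>k\<close>,
    so \<open>sum_cavg\<close>, applied to the indicator of \<open>Bad\<close>, undoes the local
    averaging.\<close>
  also have "\<dots> = (\<Sum>x\<in>V. cavg V k (\<lambda>y. (?g y)\<^sup>2) x * (if x \<in> Bad then 1 else 0))"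
    using assms(1) Bad(1) by (simp add: if_distrib sum.If_cases Int_absorb1 cong: if_cong)
  also have "\<dots> = (\<Sum>x\<in>V. (?g x)\<^sup>2 * (if x \<in> Bad then 1 else 0))"
    by (rule sum_cavg[OF assms(1)]) (use Bad(2) in metis)
  also have "\<dots> \<le> (\<Sum>x\<in>V. (?g x)\<^sup>2)"
    by (intro sum_mono) auto
  also have "\<dots> = (\<Sum>x\<in>V. (cavg V k' f x)\<^sup>2) - (\<Sum>x\<in>V. (cavg V k f x)\<^sup>2)"
    by (rule cavg_pythagoras[OF assms(1) refines])
  finally show ?thesis
    by simp
qed

section \<open>Fourier analysis on the Boolean cube\<close>

definition sg :: "bit \<Rightarrow> real" where
  "sg b = (if b = 0 then 1 else -1)"

lemma sg_add: "sg (a + b) = sg a * sg b"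
  by (cases a; cases b) (simp_all add: sg_def)

lemma sg_sum: "finite S \<Longrightarrow> sg (\<Sum>i\<in>S. f i) = (\<Prod>i\<in>S. sg (f i))"
proof (induction rule: finite_induct)
  case empty
  then show ?case by (simp add: sg_def)
next
  case (insert x F)
  then show ?case by (simp only: sum.insert prod.insert sg_add not_False_eq_True)
qed

abbreviation cube :: "nat \<Rightarrow> bit vec set" where
  "cube n \<equiv> carrier_vec n"

lemma finite_cube [simp]: "finite (cube n)"
  by (rule finite_carrier_vec_bit)

definition ch :: "bit vec \<Rightarrow> bit vec \<Rightarrow> real" where
  "ch r x = sg (scalar_prod r x)"

lemma ch_add: "r \<in> cube n \<Longrightarrow> x \<in> cube n \<Longrightarrow> y \<in> cube n \<Longrightarrow> ch r (x + y) = ch r x * ch r y"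
  unfolding ch_def using scalar_prod_add_distrib[of r n x y] sg_add by metis

lemma ch_add_left: "r \<in> cube n \<Longrightarrow> s \<in> cube n \<Longrightarrow> x \<in> cube n \<Longrightarrow> ch (r + s) x = ch r x * ch s x"
  unfolding ch_def using add_scalar_prod_distrib[of r n s x] sg_add by metis

lemma cube_add_self: "x \<in> cube n \<Longrightarrow> x + x = 0\<^sub>v n"
  by (intro eq_vecI) auto

lemma cube_add_left_cancel: "x \<in> cube n \<Longrightarrow> y \<in> cube n \<Longrightarrow> x + (x + y) = y"
  by (simp add: assoc_add_vec[of x n x y, symmetric] cube_add_self)

lemma cube_add_eq_0_iff: "x \<in> cube n \<Longrightarrow> y \<in> cube n \<Longrightarrow> x + y = 0\<^sub>v n \<longleftrightarrow> x = y"
  using cube_add_left_cancel[of x n y] by (auto simp: cube_add_self)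

lemma bij_betw_cube_add: "a \<in> cube n \<Longrightarrow> bij_betw (\<lambda>x. a + x) (cube n) (cube n)"
  by (rule bij_betwI[where g = "\<lambda>x. a + x"]) (auto simp: cube_add_left_cancel)

text \<open>Orthogonality of characters: if coordinate \<open>i\<close> of \<open>x\<close> is 1,
  adding the unit vector \<open>i\<close> to \<open>r\<close> permutes the range of summation and
  negates every term.\<close>

lemma sum_ch:
  assumes x: "x \<in> cube n"
  shows "(\<Sum>r\<in>cube n. ch r x) = (if x = 0\<^sub>v n then real (card (cube n)) else 0)"
proof (cases "x = 0\<^sub>v n")
  case True
  then show ?thesis
    by (simp add: ch_def sg_def)
next
  case False
  then obtain i where i: "i < n" "vec_index x i \<noteq> 0"
    using x eq_vecI[of x "0\<^sub>v n"] by (auto simp del: bit_not_zero_iff)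
  let ?u = "unit_vec n i :: bit vec"
  have u: "?u \<in> cube n" "ch ?u x = -1"
    using i x by (simp_all add: ch_def sg_def)
  have "(\<Sum>r\<in>cube n. ch r x) = (\<Sum>r\<in>cube n. ch (?u + r) x)"
    using sum.reindex_bij_betw[OF bij_betw_cube_add[OF u(1)], of "\<lambda>r. ch r x"] by simp
  also have "\<dots> = (\<Sum>r\<in>cube n. - ch r x)"
    using u x by (intro sum.cong refl) (simp add: ch_add_left[where n = n])
  finally show ?thesis
    using False by (simp add: sum_negf)
qed

lemma card_cube_pos: "card (cube n) > 0"
  using finite_carrier_vec_bit[of n] zero_carrier_vec[of n] by (auto simp: card_gt_0_iff simp del: zero_carrier_vec)

text \<open>Unnormalised, hence the factors \<open>card (cube n)\<close> in \<open>parseval\<close>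
  and \<open>triple_correlation\<close>; the characters are real, so no conjugate appears.\<close>

definition fourier :: "nat \<Rightarrow> (bit vec \<Rightarrow> real) \<Rightarrow> bit vec \<Rightarrow> real" where
  "fourier n F r = (\<Sum>x\<in>cube n. F x * ch r x)"

lemma sum_delta_conv:
  assumes "a \<in> cube n"
  shows "(\<Sum>w\<in>cube n. b w * (\<Sum>r\<in>cube n. ch r (a + w))) = real (card (cube n)) * b a"
proof -
  have "(\<Sum>w\<in>cube n. b w * (\<Sum>r\<in>cube n. ch r (a + w)))
    = (\<Sum>w\<in>cube n. if a = w then real (card (cube n)) * b w else 0)"
  proof (intro sum.cong refl)
    fix w assume w: "w \<in> cube n"
    have "a + w \<in> cube n" using assms w by simp
    then show "b w * (\<Sum>r\<in>cube n. ch r (a + w)) = (if a = w then real (card (cube n)) * b w else 0)"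
      using assms w by (subst sum_ch) (auto simp: cube_add_eq_0_iff)
  qed
  then show ?thesis
    using assms by (simp add: sum.delta' finite_carrier_vec_bit)
qed

lemma parseval: "(\<Sum>r\<in>cube n. (fourier n F r)\<^sup>2) = real (card (cube n)) * (\<Sum>x\<in>cube n. (F x)\<^sup>2)"
proof -
  have "(\<Sum>r\<in>cube n. (fourier n F r)\<^sup>2)
    = (\<Sum>r\<in>cube n. \<Sum>x\<in>cube n. \<Sum>y\<in>cube n. F x * (F y * ch r (x + y)))"
    by (intro sum.cong refl)
      (simp add: fourier_def power2_eq_square sum_product ch_add[where n = n] mult_ac)
  also have "\<dots> = (\<Sum>x\<in>cube n. \<Sum>r\<in>cube n. \<Sum>y\<in>cube n. F x * (F y * ch r (x + y)))"
    by (rule sum.swap)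
  also have "\<dots> = (\<Sum>x\<in>cube n. \<Sum>y\<in>cube n. \<Sum>r\<in>cube n. F x * (F y * ch r (x + y)))"
    by (intro sum.cong refl sum.swap)
  also have "\<dots> = (\<Sum>x\<in>cube n. F x * (\<Sum>y\<in>cube n. F y * (\<Sum>r\<in>cube n. ch r (x + y))))"
    by (simp add: sum_distrib_left)
  also have "\<dots> = (\<Sum>x\<in>cube n. F x * (real (card (cube n)) * F x))"
    by (simp add: sum_delta_conv)
  finally show ?thesis
    by (simp add: sum_distrib_left power2_eq_square mult_ac)
qed

text \<open>Expanding the product on the right gives the character at \<open>x + y + w\<close>;
  summing it over \<open>r\<close> leaves only \<open>w = x + y\<close>.\<close>

lemma triple_correlation:
  "real (card (cube n)) * (\<Sum>x\<in>cube n. \<Sum>y\<in>cube n. F x * G y * b (x + y))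
    = (\<Sum>r\<in>cube n. fourier n F r * fourier n G r * fourier n b r)"
proof -
  have "(\<Sum>r\<in>cube n. fourier n F r * fourier n G r * fourier n b r)
    = (\<Sum>r\<in>cube n. \<Sum>x\<in>cube n. \<Sum>y\<in>cube n. \<Sum>w\<in>cube n. F x * G y * (b w * ch r ((x + y) + w)))"
  proof (intro sum.cong refl)
    fix r assume r: "r \<in> cube n"
    have "fourier n F r * fourier n G r * fourier n b r
      = (\<Sum>x\<in>cube n. \<Sum>y\<in>cube n. F x * ch r x * (G y * ch r y)) * (\<Sum>w\<in>cube n. b w * ch r w)"
      by (simp add: fourier_def sum_product)
    also have "\<dots> = (\<Sum>x\<in>cube n. \<Sum>y\<in>cube n. \<Sum>w\<in>cube n. F x * ch r x * (G y * ch r y) * (b w * ch r w))"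
      by (simp only: sum_distrib_right) (simp only: sum_distrib_left)
    also have "\<dots> = (\<Sum>x\<in>cube n. \<Sum>y\<in>cube n. \<Sum>w\<in>cube n. F x * G y * (b w * ch r ((x + y) + w)))"
      using r by (intro sum.cong refl) (simp add: ch_add[where n = n])
    finally show "fourier n F r * fourier n G r * fourier n b r
      = (\<Sum>x\<in>cube n. \<Sum>y\<in>cube n. \<Sum>w\<in>cube n. F x * G y * (b w * ch r ((x + y) + w)))" .
  qed
  also have "\<dots> = (\<Sum>x\<in>cube n. \<Sum>r\<in>cube n. \<Sum>y\<in>cube n. \<Sum>w\<in>cube n. F x * G y * (b w * ch r ((x + y) + w)))"
    by (rule sum.swap)
  also have "\<dots> = (\<Sum>x\<in>cube n. \<Sum>y\<in>cube n. \<Sum>r\<in>cube n. \<Sum>w\<in>cube n. F x * G y * (b w * ch r ((x + y) + w)))"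
    by (intro sum.cong refl sum.swap)
  also have "\<dots> = (\<Sum>x\<in>cube n. \<Sum>y\<in>cube n. \<Sum>w\<in>cube n. \<Sum>r\<in>cube n. F x * G y * (b w * ch r ((x + y) + w)))"
    by (intro sum.cong refl sum.swap)
  also have "\<dots> = (\<Sum>x\<in>cube n. \<Sum>y\<in>cube n. F x * G y * (\<Sum>w\<in>cube n. b w * (\<Sum>r\<in>cube n. ch r ((x + y) + w))))"
    by (simp add: sum_distrib_left)
  also have "\<dots> = (\<Sum>x\<in>cube n. \<Sum>y\<in>cube n. F x * G y * (real (card (cube n)) * b (x + y)))"
    by (intro sum.cong refl) (subst sum_delta_conv, simp_all)
  also have "\<dots> = real (card (cube n)) * (\<Sum>x\<in>cube n. \<Sum>y\<in>cube n. F x * G y * b (x + y))"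
    by (simp only: sum_distrib_left mult.left_commute[of _ "real (card (cube n))"])
  finally show ?thesis ..
qed

section \<open>A regularity lemma for the Boolean cube\<close>

text \<open>On the cube the fibres are the cosets of the annihilator of \<open>R\<close>. The
  restriction puts the labels into an extensional function space, which has
  \<open>2 ^ card R\<close> elements for finite \<open>R\<close>.\<close>

definition lab :: "bit vec set \<Rightarrow> bit vec \<Rightarrow> bit vec \<Rightarrow> bit" where
  "lab R x = restrict (\<lambda>r. scalar_prod r x) R"

lemma lab_eq_iff: "lab R x = lab R y \<longleftrightarrow> (\<forall>r\<in>R. scalar_prod r x = scalar_prod r y)"
  by (auto simp: lab_def restrict_def fun_eq_iff)

lemma lab_mono: "R \<subseteq> R' \<Longrightarrow> lab R' x = lab R' y \<Longrightarrow> lab R x = lab R y"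
  by (auto simp: lab_eq_iff)

lemma lab_add:
  assumes "R \<subseteq> cube n" "x \<in> cube n" "y \<in> cube n" "x' \<in> cube n" "y' \<in> cube n"
    and "lab R x = lab R x'" "lab R y = lab R y'"
  shows "lab R (x + y) = lab R (x' + y')"
  unfolding lab_eq_iff
proof
  fix r assume r: "r \<in> R"
  then have "r \<in> cube n"
    using assms(1) by auto
  moreover have "scalar_prod r x = scalar_prod r x'" "scalar_prod r y = scalar_prod r y'"
    using r assms(6,7) by (auto simp: lab_eq_iff)
  ultimately show "scalar_prod r (x + y) = scalar_prod r (x' + y')"
    using scalar_prod_add_distrib[of r n] assms(2-5) by metis
qed

lemma card_UNIV_bit: "card (UNIV :: bit set) = 2"
  by (simp add: UNIV_bit)

lemma finite_UNIV_bit: "finite (UNIV :: bit set)"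
  by (simp add: UNIV_bit)

lemma card_lab_image:
  assumes "finite R"
  shows "finite (lab R ` X)" "card (lab R ` X) \<le> 2 ^ card R"
proof -
  have sub: "lab R ` X \<subseteq> R \<rightarrow>\<^sub>E UNIV"
    by (auto simp: lab_def)
  have fin: "finite (R \<rightarrow>\<^sub>E (UNIV :: bit set))"
    using assms by (intro finite_PiE) (simp_all add: finite_UNIV_bit)
  show "finite (lab R ` X)"
    using sub fin by (rule finite_subset)
  show "card (lab R ` X) \<le> 2 ^ card R"
    using card_mono[OF fin sub] assms by (simp add: card_PiE card_UNIV_bit)
qed

abbreviation atom :: "nat \<Rightarrow> bit vec set \<Rightarrow> bit vec \<Rightarrow> bit vec set" where
  "atom n R x \<equiv> {y\<in>cube n. lab R y = lab R x}"

text \<open>Both atoms are cosets of one subspace; adding \<open>x\<close> is an involution that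
  exchanges them.\<close>

lemma card_atom:
  assumes "R \<subseteq> cube n" "x \<in> cube n"
  shows "card (atom n R x) = card (atom n R (0\<^sub>v n))"
proof -
  have x0: "x + 0\<^sub>v n = x"
    using assms by simp
  have "bij_betw (\<lambda>y. x + y) (atom n R (0\<^sub>v n)) (atom n R x)"
  proof (rule bij_betwI[where g = "\<lambda>y. x + y"])
    show "(\<lambda>y. x + y) \<in> atom n R (0\<^sub>v n) \<rightarrow> atom n R x"
    proof
      fix y assume "y \<in> atom n R (0\<^sub>v n)"
      then have y: "y \<in> cube n" "lab R y = lab R (0\<^sub>v n)"
        by simp_all
      have "lab R (x + y) = lab R (x + 0\<^sub>v n)"
        by (rule lab_add[OF assms(1,2) y(1) assms(2) zero_carrier_vec refl y(2)])
      then show "x + y \<in> atom n R x"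
        using y(1) assms(2) x0 by simp
    qed
    show "(\<lambda>y. x + y) \<in> atom n R x \<rightarrow> atom n R (0\<^sub>v n)"
    proof
      fix y assume "y \<in> atom n R x"
      then have y: "y \<in> cube n" "lab R y = lab R x"
        by simp_all
      have "lab R (x + y) = lab R (x + x)"
        by (rule lab_add[OF assms(1,2) y(1) assms(2) assms(2) refl y(2)])
      then show "x + y \<in> atom n R (0\<^sub>v n)"
        using y(1) assms(2) by (simp add: cube_add_self)
    qed
  qed (use assms(2) in \<open>simp_all add: cube_add_left_cancel[of x n]\<close>)
  then show ?thesis
    by (simp add: bij_betw_same_card)
qed

text \<open>At most \<open>2 ^ card R\<close> atoms of equal size cover the cube. This lower bound
  on the density of an atom is what frees the removal constant from the dimension.\<close>

lemma card_cube_le: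
  assumes "R \<subseteq> cube n"
  shows "card (cube n) \<le> 2 ^ card R * card (atom n R (0\<^sub>v n))"
proof -
  have fR: "finite R"
    using assms finite_cube by (rule finite_subset)
  have "cube n = (\<Union>l\<in>lab R ` cube n. {y\<in>cube n. lab R y = l})"
    by auto
  then have "card (cube n) = card (\<Union>l\<in>lab R ` cube n. {y\<in>cube n. lab R y = l})"
    by (rule arg_cong)
  also have "\<dots> \<le> (\<Sum>l\<in>lab R ` cube n. card {y\<in>cube n. lab R y = l})"
    by (rule card_UN_le) (rule card_lab_image[OF fR])
  also have "\<dots> \<le> (\<Sum>l\<in>lab R ` cube n. card (atom n R (0\<^sub>v n)))"
  proof (rule sum_mono)
    fix l assume "l \<in> lab R ` cube n"
    then obtain x where x: "x \<in> cube n" "l = lab R x"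
      by auto
    show "card {y\<in>cube n. lab R y = l} \<le> card (atom n R (0\<^sub>v n))"
      unfolding x(2) card_atom[OF assms x(1)] ..
  qed
  also have "\<dots> = card (lab R ` cube n) * card (atom n R (0\<^sub>v n))"
    by simp
  also have "\<dots> \<le> 2 ^ card R * card (atom n R (0\<^sub>v n))"
    using card_lab_image[OF fR] by (intro mult_right_mono) auto
  finally show ?thesis .
qed

abbreviation mean :: "nat \<Rightarrow> bit vec set \<Rightarrow> (bit vec \<Rightarrow> real) \<Rightarrow> bit vec \<Rightarrow> real" where
  "mean n R \<equiv> cavg (cube n) (lab R)"

text \<open>The balanced function, \<open>f\<close> minus its mean, correlates with some character
  on the atom of \<open>x\<close>. The factor 2 is lost when the atom is cut in two by that
  character.\<close>

definition irregular :: "nat \<Rightarrow> bit vec set \<Rightarrow> (bit vec \<Rightarrow> real) \<Rightarrow> real \<Rightarrow> bit vec set" where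
  "irregular n R f \<eta> = {x\<in>cube n. \<exists>r\<in>cube n.
     \<bar>\<Sum>y\<in>atom n R x. (f y - mean n R f y) * ch r y\<bar> > 2 * \<eta> * card (atom n R x)}"

lemma sum_mean_atom:
  assumes "x \<in> cube n"
  shows "(\<Sum>y\<in>atom n R x. mean n R f y) = (\<Sum>y\<in>atom n R x. f y)"
proof -
  have "(\<Sum>y\<in>atom n R x. mean n R f y) = (\<Sum>y\<in>atom n R x. mean n R f x)"
    by (intro sum.cong refl cavg_cong) auto
  also have "\<dots> = real (card (atom n R x)) * mean n R f x"
    by simp
  also have "\<dots> = (\<Sum>y\<in>atom n R x. f y)"
  proof -
    have "card (atom n R x) \<noteq> 0"
      using assms by auto
    then show ?thesis
      by (simp add: cavg_def)
  qed
  finally show ?thesis .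
qed

text \<open>One witnessing frequency per irregular atom suffices; it is chosen by label and not by
  point, so at most \<open>2 ^ card R\<close> frequencies are added. Each splits its atom into two
  halves on which \<open>f\<close> deviates from its mean.\<close>

lemma irregular_increment:
  assumes R: "R \<subseteq> cube n" and \<eta>: "\<eta> \<ge> 0"
  obtains R' where "R' \<subseteq> cube n" "card R' \<le> card R + 2 ^ card R"
    "(\<Sum>x\<in>cube n. (mean n R' f x)\<^sup>2) \<ge> (\<Sum>x\<in>cube n. (mean n R f x)\<^sup>2) + \<eta>\<^sup>2 * card (irregular n R f \<eta>)"
proof -
  let ?Bad = "irregular n R f \<eta>"
  let ?F = "\<lambda>y. f y - mean n R f y"
  have fR: "finite R"
    using R finite_cube by (rule finite_subset)
  have "\<forall>l\<in>lab R ` ?Bad. \<exists>r. r \<in> cube n \<and>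
    \<bar>\<Sum>y\<in>{y\<in>cube n. lab R y = l}. ?F y * ch r y\<bar> > 2 * \<eta> * card {y\<in>cube n. lab R y = l}"
  proof
    fix l assume "l \<in> lab R ` ?Bad"
    then obtain x where x: "x \<in> ?Bad" "l = lab R x"
      by (rule imageE)
    show "\<exists>r. r \<in> cube n \<and>
      \<bar>\<Sum>y\<in>{y\<in>cube n. lab R y = l}. ?F y * ch r y\<bar> > 2 * \<eta> * card {y\<in>cube n. lab R y = l}"
      using x(1) unfolding x(2) irregular_def by blast
  qed
  from bchoice[OF this] obtain g where g: "\<And>l. l \<in> lab R ` ?Bad \<Longrightarrow> g l \<in> cube n"
    "\<And>l. l \<in> lab R ` ?Bad \<Longrightarrow> \<bar>\<Sum>y\<in>{y\<in>cube n. lab R y = l}. ?F y * ch (g l) y\<bar>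
      > 2 * \<eta> * card {y\<in>cube n. lab R y = l}"
    by blast
  define R' where "R' = R \<union> g ` lab R ` ?Bad"
  have "card R' \<le> card R + card (g ` lab R ` ?Bad)"
    unfolding R'_def by (rule card_Un_le)
  also have "\<dots> \<le> card R + card (lab R ` ?Bad)"
    using card_lab_image[OF fR] by (simp add: card_image_le)
  also have "\<dots> \<le> card R + 2 ^ card R"
    using card_lab_image[OF fR] by simp
  finally have c: "card R' \<le> card R + 2 ^ card R" .
  have e: "(\<Sum>x\<in>cube n. (mean n R' f x)\<^sup>2) \<ge> (\<Sum>x\<in>cube n. (mean n R f x)\<^sup>2) + \<eta>\<^sup>2 * card ?Bad"
  proof (rule energy_increment[OF finite_cube \<eta>])
    show "lab R x = lab R y" if "lab R' x = lab R' y" for x y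
      using that by (rule lab_mono[rotated]) (simp add: R'_def)
    show "?Bad \<subseteq> cube n"
      by (auto simp: irregular_def)
    show "y \<in> ?Bad" if "x \<in> ?Bad" "y \<in> cube n" "lab R x = lab R y" for x y
      using that by (simp add: irregular_def)
  next
    fix x assume x: "x \<in> ?Bad"
    then have xc: "x \<in> cube n"
      by (simp add: irregular_def)
    define r where "r = g (lab R x)"
    have rR': "r \<in> R'"
      using x by (auto simp: r_def R'_def)
    let ?C = "atom n R x"
    let ?D = "{y\<in>?C. scalar_prod r y = 0}" and ?E = "{y\<in>?C. scalar_prod r y \<noteq> 0}"
    have big: "\<bar>\<Sum>y\<in>?C. ?F y * ch r y\<bar> > 2 * \<eta> * card ?C"
      using g(2)[of "lab R x"] x by (simp add: r_def)
    have split: "(\<Sum>y\<in>?C. h y) = (\<Sum>y\<in>?D. h y) + (\<Sum>y\<in>?E. h y)" for h :: "bit vec \<Rightarrow> real"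
      by (subst sum.union_disjoint[symmetric]) (auto intro!: sum.cong)
    have "(\<Sum>y\<in>?C. ?F y) = 0"
      using sum_mean_atom[OF xc, of R f] by (simp add: sum_subtractf)
    then have z: "(\<Sum>y\<in>?D. ?F y) + (\<Sum>y\<in>?E. ?F y) = 0"
      using split[of ?F] by simp
    have "(\<Sum>y\<in>?C. ?F y * ch r y) = (\<Sum>y\<in>?D. ?F y * ch r y) + (\<Sum>y\<in>?E. ?F y * ch r y)"
      by (rule split)
    also have "(\<Sum>y\<in>?D. ?F y * ch r y) = (\<Sum>y\<in>?D. ?F y)"
      by (intro sum.cong refl) (auto simp: ch_def sg_def)
    also have "(\<Sum>y\<in>?E. ?F y * ch r y) = (\<Sum>y\<in>?E. - ?F y)"
      by (intro sum.cong refl) (auto simp: ch_def sg_def)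
    also have "\<dots> = - (\<Sum>y\<in>?E. ?F y)"
      by (rule sum_negf)
    \<comment> \<open>The balanced function sums to 0 over the atom, so its sums over the halves are
      opposite and the character sum is twice the sum over \<open>?D\<close>.\<close>
    finally have dev: "\<bar>\<Sum>y\<in>?D. ?F y\<bar> \<ge> \<eta> * card ?C"
      using z big by linarith
    have closed: "\<forall>y\<in>?D. \<forall>z\<in>cube n. lab R' y = lab R' z \<longrightarrow> z \<in> ?D"
    proof (intro ballI impI)
      fix y z assume yz: "y \<in> ?D" "z \<in> cube n" "lab R' y = lab R' z"
      have y: "lab R y = lab R x" "scalar_prod r y = 0"
        using yz(1) by blast+
      have "lab R y = lab R z"
        using yz(3) by (rule lab_mono[rotated]) (simp add: R'_def)
      then have 1: "lab R z = lab R x"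
        using y(1) by (rule trans[OF sym])
      have "scalar_prod r y = scalar_prod r z"
        using yz(3) rR' unfolding lab_eq_iff by blast
      then have 2: "scalar_prod r z = 0"
        using y(2) by (rule trans[OF sym])
      show "z \<in> ?D"
        using yz(2) 1 2 by blast
    qed
    have "?D \<subseteq> ?C"
      by blast
    with closed dev show "\<exists>D\<subseteq>?C. (\<forall>y\<in>D. \<forall>z\<in>cube n. lab R' y = lab R' z \<longrightarrow> z \<in> D) \<and>
      \<bar>\<Sum>y\<in>D. ?F y\<bar> \<ge> \<eta> * card ?C"
      by (intro exI[of _ ?D] conjI)
  qed
  have "R' \<subseteq> cube n"
    using R g(1) by (auto simp: R'_def)
  then show ?thesis
    using that c e by blast
qed

text \<open>Of tower type, since a refinement step may add a frequency for each atom of the current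
  partition.\<close>

primrec regularity_bound :: "nat \<Rightarrow> nat" where
  "regularity_bound 0 = 0"
| "regularity_bound (Suc i) = regularity_bound i + 2 ^ regularity_bound i"

lemma regularity_iteration:
  fixes \<epsilon> \<eta> :: real
  assumes "\<eta> > 0"
  shows "(\<exists>R\<subseteq>cube n. card R \<le> regularity_bound i \<and>
      real (card (irregular n R f \<eta>)) \<le> \<epsilon> * card (cube n)) \<or>
    (\<exists>R\<subseteq>cube n. card R \<le> regularity_bound i \<and>
      (\<Sum>x\<in>cube n. (mean n R f x)\<^sup>2) \<ge> real i * (\<eta>\<^sup>2 * (\<epsilon> * card (cube n))))"
proof (induction i)
  case 0
  then show ?case
    by (auto intro!: exI[of _ "{}"] sum_nonneg)
next
  case (Suc i)
  then show ?case
  proof (elim disjE exE conjE)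
    fix R assume "R \<subseteq> cube n" "card R \<le> regularity_bound i"
      "real (card (irregular n R f \<eta>)) \<le> \<epsilon> * card (cube n)"
    then show ?thesis
      by (intro disjI1 exI[of _ R]) auto
  next
    fix R assume R: "R \<subseteq> cube n" "card R \<le> regularity_bound i"
      "(\<Sum>x\<in>cube n. (mean n R f x)\<^sup>2) \<ge> real i * (\<eta>\<^sup>2 * (\<epsilon> * card (cube n)))"
    show ?thesis
    proof (cases "real (card (irregular n R f \<eta>)) \<le> \<epsilon> * card (cube n)")
      case True
      then show ?thesis
        using R by (intro disjI1 exI[of _ R]) auto
    next
      case False
      obtain R' where R': "R' \<subseteq> cube n" "card R' \<le> card R + 2 ^ card R"
        "(\<Sum>x\<in>cube n. (mean n R' f x)\<^sup>2)
          \<ge> (\<Sum>x\<in>cube n. (mean n R f x)\<^sup>2) + \<eta>\<^sup>2 * card (irregular n R f \<eta>)"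
        using irregular_increment[OF R(1), of \<eta> f] assms by auto
      have "(2::nat) ^ card R \<le> 2 ^ regularity_bound i"
        using R(2) by (intro power_increasing) auto
      then have "card R' \<le> regularity_bound (Suc i)"
        using R(2) R'(2) by (simp only: regularity_bound.simps)
      moreover have "\<eta>\<^sup>2 * (\<epsilon> * card (cube n)) \<le> \<eta>\<^sup>2 * card (irregular n R f \<eta>)"
        using False by (intro mult_left_mono) auto
      then have "(\<Sum>x\<in>cube n. (mean n R' f x)\<^sup>2) \<ge> real (Suc i) * (\<eta>\<^sup>2 * (\<epsilon> * card (cube n)))"
        using R(3) R'(3) by (simp add: algebra_simps)
      ultimately show ?thesis
        using R'(1) by blast
    qed
  qed
qed

lemma regularity:
  fixes \<epsilon> \<eta> :: real
  assumes "\<eta> > 0" "\<epsilon> > 0"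
  obtains K where "\<And>n f. (\<And>x. x \<in> cube n \<Longrightarrow> 0 \<le> f x \<and> f x \<le> 1) \<Longrightarrow>
    \<exists>R\<subseteq>cube n. card R \<le> K \<and> real (card (irregular n R f \<eta>)) \<le> \<epsilon> * card (cube n)"
proof -
  \<comment> \<open>All means lie between 0 and 1, so the energy is at most
    \<open>card (cube n)\<close>, and \<open>i\<close> gains of
    \<open>\<eta>\<^sup>2 * \<epsilon> * card (cube n)\<close> would exceed it. The choice of
    \<open>i\<close> involves neither the dimension nor the function.\<close>
  obtain i where i: "real i * (\<eta>\<^sup>2 * \<epsilon>) > 1"
    using assms reals_Archimedean3[of "\<eta>\<^sup>2 * \<epsilon>"] by auto
  have "\<exists>R\<subseteq>cube n. card R \<le> regularity_bound i \<and> real (card (irregular n R f \<eta>)) \<le> \<epsilon> * card (cube n)"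
    if f: "\<And>x. x \<in> cube n \<Longrightarrow> 0 \<le> f x \<and> f x \<le> 1" for n f
  proof (rule ccontr)
    assume "\<not> ?thesis"
    then obtain R where R: "(\<Sum>x\<in>cube n. (mean n R f x)\<^sup>2) \<ge> real i * (\<eta>\<^sup>2 * (\<epsilon> * card (cube n)))"
      using regularity_iteration[OF assms(1), of n i f \<epsilon>] by blast
    have "mean n R f x \<in> {0..1}" if "x \<in> cube n" for x
      using cavg_mono[of "cube n" "lab R" x "\<lambda>_. 0" f] cavg_mono[of "cube n" "lab R" x f "\<lambda>_. 1"]
        f that by (simp add: cavg_const)
    then have "(\<Sum>x\<in>cube n. (mean n R f x)\<^sup>2) \<le> (\<Sum>x\<in>cube n. 1)"
      by (intro sum_mono) (simp add: power_le_one)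
    then have "real i * (\<eta>\<^sup>2 * \<epsilon>) * card (cube n) \<le> 1 * real (card (cube n))"
      using R by (simp add: mult_ac)
    then have "real i * (\<eta>\<^sup>2 * \<epsilon>) \<le> 1"
      by (rule mult_right_le_imp_le) (simp add: card_cube_pos)
    then show False
      using i by simp
  qed
  then show ?thesis
    using that by blast
qed

section \<open>Triangle removal\<close>

text \<open>With the factors restricted to the cells of \<open>x\<close>, \<open>y\<close> and
  \<open>x + y\<close>, replacing the third by its mean gives the main term. The error is a triple
  correlation: the Fourier coefficients of the balanced third factor are uniformly small, and
  Parseval controls the other two. Hence regularity is asked of one cell only.\<close>

lemma counting:
  assumes R: "R \<subseteq> cube n" and x: "x \<in> cube n" and y: "y \<in> cube n"
    and e: "e > 0" and \<eta>: "\<eta> > 0"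
    and f: "\<And>u. u \<in> cube n \<Longrightarrow> 0 \<le> f u \<and> f u \<le> 1"
    and dense: "mean n R f x \<ge> e" "mean n R f y \<ge> e" "mean n R f (x + y) \<ge> e"
    and reg: "x + y \<notin> irregular n R f \<eta>"
  shows "(\<Sum>u\<in>cube n. \<Sum>v\<in>cube n. f u * f v * f (u + v))
    \<ge> (e ^ 3 - 2 * \<eta>) * (real (card (atom n R (0\<^sub>v n))))\<^sup>2"
proof -
  define h where "h = real (card (atom n R (0\<^sub>v n)))"
  have "0\<^sub>v n \<in> atom n R (0\<^sub>v n)"
    by simp
  then have h0: "h > 0"
    unfolding h_def using finite_cube by (auto simp: card_gt_0_iff simp del: zero_carrier_vec)
  have z: "x + y \<in> cube n"
    using x y by simp
  define N where "N = real (card (cube n))"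
  have N0: "N > 0"
    by (simp add: N_def card_cube_pos)
  define \<alpha> where "\<alpha> = mean n R f (x + y)"
  define loc where "loc a u = (if lab R u = lab R a then f u else 0)" for a u
  \<comment> \<open>Centering the third factor makes its Fourier coefficients small at every character, including those trivial on the atoms.\<close>
  define b where "b w = (if lab R w = lab R (x + y) then f w - mean n R f w else 0)" for w
  have sum_loc: "(\<Sum>u\<in>cube n. loc a u) = h * mean n R f a" if "a \<in> cube n" for a
  proof -
    have "(\<Sum>u\<in>cube n. loc a u) = (\<Sum>u\<in>atom n R a. f u)"
      unfolding loc_def by (rule sum.inter_filter[symmetric]) simp
    also have "\<dots> = h * ((\<Sum>u\<in>atom n R a. f u) / h)"
      using h0 by simp
    also have "\<dots> = h * mean n R f a"
      by (simp only: cavg_def h_def card_atom[OF R that])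
    finally show ?thesis .
  qed
  have loc01: "0 \<le> loc a u" "loc a u \<le> f u" "(loc a u)\<^sup>2 \<le> (if lab R u = lab R a then 1 else 0)"
    if "u \<in> cube n" for a u
    using f[OF that] by (auto simp: loc_def power_le_one)
  have loc2: "(\<Sum>u\<in>cube n. (loc a u)\<^sup>2) \<le> h" if "a \<in> cube n" for a
  proof -
    have "(\<Sum>u\<in>cube n. (loc a u)\<^sup>2) \<le> (\<Sum>u\<in>cube n. if lab R u = lab R a then 1 else 0)"
      by (intro sum_mono loc01)
    also have "\<dots> = (\<Sum>u\<in>atom n R a. 1)"
      by (rule sum.inter_filter[symmetric]) simp
    also have "\<dots> = h"
      using card_atom[OF R that] by (simp add: h_def)
    finally show ?thesis .
  qed
  \<comment> \<open>For \<open>u\<close> and \<open>v\<close> in the cells of \<open>x\<close> and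
    \<open>y\<close>, the point \<open>u + v\<close> is automatically in the cell of
    \<open>x + y\<close>, where the mean is constantly \<open>\<alpha>\<close>.\<close>
  have split: "loc x u * loc y v * loc (x + y) (u + v)
    = \<alpha> * (loc x u * loc y v) + loc x u * loc y v * b (u + v)"
    if "u \<in> cube n" "v \<in> cube n" for u v
  proof (cases "lab R u = lab R x \<and> lab R v = lab R y")
    case True
    then have "lab R (u + v) = lab R (x + y)"
      using lab_add[OF R that(1,2) x y] by simp
    moreover from this have "mean n R f (u + v) = \<alpha>"
      unfolding \<alpha>_def by (rule cavg_cong)
    ultimately show ?thesis
      by (simp add: loc_def[of "x + y"] b_def algebra_simps)
  next
    case False
    then show ?thesis
      by (auto simp: loc_def)
  qed
  have fb: "\<bar>fourier n b r\<bar> \<le> 2 * \<eta> * h" if r: "r \<in> cube n" for r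
  proof -
    have "fourier n b r = (\<Sum>w\<in>cube n. if lab R w = lab R (x + y) then (f w - mean n R f w) * ch r w else 0)"
      unfolding fourier_def by (intro sum.cong refl) (simp add: b_def)
    also have "\<dots> = (\<Sum>w\<in>atom n R (x + y). (f w - mean n R f w) * ch r w)"
      by (rule sum.inter_filter[symmetric]) simp
    finally show ?thesis
      using reg r z card_atom[OF R z] by (force simp: irregular_def h_def)
  qed
  let ?S = "\<Sum>u\<in>cube n. \<Sum>v\<in>cube n. loc x u * loc y v * b (u + v)"
  have "\<bar>N * ?S\<bar> = \<bar>\<Sum>r\<in>cube n. fourier n (loc x) r * fourier n (loc y) r * fourier n b r\<bar>"
    unfolding N_def by (subst triple_correlation) simp
  also have "\<dots> \<le> (\<Sum>r\<in>cube n. \<bar>fourier n (loc x) r * fourier n (loc y) r * fourier n b r\<bar>)"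
    by (rule sum_abs)
  also have "\<dots> \<le> (\<Sum>r\<in>cube n. ((fourier n (loc x) r)\<^sup>2 + (fourier n (loc y) r)\<^sup>2) * (\<eta> * h))"
  proof (intro sum_mono)
    fix r assume r: "r \<in> cube n"
    let ?a = "\<bar>fourier n (loc x) r\<bar>" and ?b = "\<bar>fourier n (loc y) r\<bar>"
    \<comment> \<open>The inequality of arithmetic and geometric means absorbs the factor 2 of
      \<open>fb\<close> and leaves two sums to which \<open>parseval\<close> applies
      separately.\<close>
    have "2 * (?a * ?b) \<le> ?a\<^sup>2 + ?b\<^sup>2"
      using sum_squares_bound[of ?a ?b] by (simp only: mult.assoc)
    then have "2 * (?a * ?b) * (\<eta> * h) \<le> (?a\<^sup>2 + ?b\<^sup>2) * (\<eta> * h)"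
      using \<eta> h0 by (intro mult_right_mono) auto
    moreover have "?a * ?b * \<bar>fourier n b r\<bar> \<le> ?a * ?b * (2 * \<eta> * h)"
      using fb[OF r] by (intro mult_left_mono) auto
    ultimately show "\<bar>fourier n (loc x) r * fourier n (loc y) r * fourier n b r\<bar>
      \<le> ((fourier n (loc x) r)\<^sup>2 + (fourier n (loc y) r)\<^sup>2) * (\<eta> * h)"
      by (simp add: abs_mult mult_ac)
  qed
  also have "\<dots> = ((\<Sum>r\<in>cube n. (fourier n (loc x) r)\<^sup>2) + (\<Sum>r\<in>cube n. (fourier n (loc y) r)\<^sup>2)) * (\<eta> * h)"
    by (simp only: sum_distrib_right[symmetric] sum.distrib)
  also have "\<dots> = N * ((\<Sum>u\<in>cube n. (loc x u)\<^sup>2) + (\<Sum>u\<in>cube n. (loc y u)\<^sup>2)) * (\<eta> * h)"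
    by (simp only: parseval N_def distrib_left)
  also have "\<dots> \<le> N * (h + h) * (\<eta> * h)"
    using N0 h0 \<eta> by (intro mult_right_mono mult_left_mono add_mono loc2 x y) auto
  also have "\<dots> = N * (2 * \<eta> * h\<^sup>2)"
    by (simp add: power2_eq_square)
  finally have "N * \<bar>?S\<bar> \<le> N * (2 * \<eta> * h\<^sup>2)"
    using N0 by (simp only: abs_mult abs_of_pos)
  then have S: "\<bar>?S\<bar> \<le> 2 * \<eta> * h\<^sup>2"
    using N0 by (rule mult_left_le_imp_le)
  have "(\<Sum>u\<in>cube n. \<Sum>v\<in>cube n. loc x u * loc y v * loc (x + y) (u + v))
    = (\<Sum>u\<in>cube n. \<Sum>v\<in>cube n. \<alpha> * (loc x u * loc y v) + loc x u * loc y v * b (u + v))"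
    by (intro sum.cong refl split)
  also have "\<dots> = (\<Sum>u\<in>cube n. \<Sum>v\<in>cube n. \<alpha> * (loc x u * loc y v)) + ?S"
    by (simp only: sum.distrib)
  also have "(\<Sum>u\<in>cube n. \<Sum>v\<in>cube n. \<alpha> * (loc x u * loc y v))
    = \<alpha> * ((\<Sum>u\<in>cube n. loc x u) * (\<Sum>v\<in>cube n. loc y v))"
    by (subst sum_product) (simp only: sum_distrib_left)
  also have "\<dots> = mean n R f (x + y) * mean n R f x * mean n R f y * h\<^sup>2"
    using sum_loc[OF x] sum_loc[OF y] by (simp add: \<alpha>_def power2_eq_square)
  finally have main: "(\<Sum>u\<in>cube n. \<Sum>v\<in>cube n. loc x u * loc y v * loc (x + y) (u + v))
    = mean n R f (x + y) * mean n R f x * mean n R f y * h\<^sup>2 + ?S" .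
  have "e * e * e \<le> mean n R f (x + y) * mean n R f x * mean n R f y"
    using dense e by (intro mult_mono mult_nonneg_nonneg) auto
  then have "e ^ 3 * h\<^sup>2 \<le> mean n R f (x + y) * mean n R f x * mean n R f y * h\<^sup>2"
    by (intro mult_right_mono) (simp_all add: power3_eq_cube)
  then have "(e ^ 3 - 2 * \<eta>) * h\<^sup>2 \<le> (\<Sum>u\<in>cube n. \<Sum>v\<in>cube n. loc x u * loc y v * loc (x + y) (u + v))"
    using main S by (simp add: left_diff_distrib)
  also have "\<dots> \<le> (\<Sum>u\<in>cube n. \<Sum>v\<in>cube n. f u * f v * f (u + v))"
    by (intro sum_mono mult_mono loc01 mult_nonneg_nonneg) (auto simp: f)
  finally show ?thesis
    by (simp add: h_def)
qed

text \<open>Deleted are the points of \<open>A\<close> in irregular atoms and those in atoms where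
  \<open>A\<close> has density below \<open>e\<close>. Each kind takes at most the fraction
  \<open>\<epsilon> / 2\<close> of the cube: the first by regularity, the second because
  \<open>sum_cavg\<close> replaces the indicator of \<open>A\<close> by its mean on a union of
  atoms. A triangle that survives would, by \<open>counting\<close>, bring too many others with
  it.\<close>

lemma triangle_removal:
  fixes \<epsilon> :: real
  assumes \<epsilon>: "\<epsilon> > 0"
  shows "\<exists>\<delta>>0. \<forall>n. \<forall>A\<subseteq>cube n.
    real (card {(x, y)\<in>cube n \<times> cube n. x \<in> A \<and> y \<in> A \<and> x + y \<in> A}) < \<delta> * (real (card (cube n)))\<^sup>2 \<longrightarrow>
    (\<exists>B\<subseteq>A. real (card (A - B)) \<le> \<epsilon> * card (cube n) \<and> (\<forall>x\<in>B. \<forall>y\<in>B. x + y \<notin> B))"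
proof -
  define e where "e = \<epsilon> / 2"
  have e: "e > 0"
    using \<epsilon> by (simp add: e_def)
  \<comment> \<open>The loss \<open>2 * \<eta>\<close> in \<open>counting\<close> becomes half of
    the main term \<open>e ^ 3\<close>.\<close>
  define \<eta> where "\<eta> = e ^ 3 / 4"
  have \<eta>: "\<eta> > 0"
    using e by (simp add: \<eta>_def)
  obtain K where K: "\<And>n f. (\<And>x. x \<in> cube n \<Longrightarrow> 0 \<le> f x \<and> f x \<le> 1) \<Longrightarrow>
    \<exists>R\<subseteq>cube n. card R \<le> K \<and> real (card (irregular n R f \<eta>)) \<le> e * card (cube n)"
    using regularity[OF \<eta> e] by blast
  \<comment> \<open>An atom fills at least the fraction \<open>1 / 2 ^ K\<close> of the cube, so one
    surviving triangle forces at least this proportion of all pairs to span triangles.\<close>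
  define \<delta> where "\<delta> = e ^ 3 / 2 / (2 ^ K)\<^sup>2"
  have "\<delta> > 0"
    using e by (simp add: \<delta>_def)
  have removal: "\<exists>B\<subseteq>A. real (card (A - B)) \<le> \<epsilon> * card (cube n) \<and> (\<forall>x\<in>B. \<forall>y\<in>B. x + y \<notin> B)"
    if A: "A \<subseteq> cube n"
      and few: "real (card {(x, y)\<in>cube n \<times> cube n. x \<in> A \<and> y \<in> A \<and> x + y \<in> A}) < \<delta> * (real (card (cube n)))\<^sup>2"
    for n A
  proof -
    define f where "f = (\<lambda>x. if x \<in> A then 1 else 0 :: real)"
    have f: "0 \<le> f x \<and> f x \<le> 1" for x
      by (simp add: f_def)
    obtain R where R: "R \<subseteq> cube n" "card R \<le> K"
      and irr: "real (card (irregular n R f \<eta>)) \<le> e * card (cube n)"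
      using K[of n f] f by blast
    let ?m = "mean n R f"
    define B where "B = {x\<in>A. ?m x \<ge> e \<and> x \<notin> irregular n R f \<eta>}"
    define L where "L = {x\<in>A. ?m x < e}"
    have fA: "finite A"
      using A finite_cube by (rule finite_subset)
    have fi: "finite (irregular n R f \<eta>)"
      by (simp add: irregular_def)
    have "real (card L) = (\<Sum>x\<in>cube n. f x * (if ?m x < e then 1 else 0))"
    proof -
      have "(\<Sum>x\<in>cube n. f x * (if ?m x < e then 1 else 0)) = (\<Sum>x\<in>cube n. if x \<in> L then 1 else 0)"
        by (intro sum.cong refl) (auto simp: f_def L_def)
      also have "\<dots> = (\<Sum>x\<in>{x\<in>cube n. x \<in> L}. 1)"
        by (rule sum.inter_filter[symmetric]) simp
      also have "{x\<in>cube n. x \<in> L} = L"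
        using A by (auto simp: L_def)
      finally show ?thesis by simp
    qed
    also have "\<dots> = (\<Sum>x\<in>cube n. ?m x * (if ?m x < e then 1 else 0))"
    proof (rule sum_cavg[symmetric, OF finite_cube])
      fix x y assume "lab R x = lab R y"
      then have "?m x = ?m y" by (rule cavg_cong)
      then show "(if ?m x < e then 1 else 0 :: real) = (if ?m y < e then 1 else 0)" by simp
    qed
    also have "\<dots> \<le> (\<Sum>x\<in>cube n. e)"
      using e by (intro sum_mono) auto
    finally have L: "real (card L) \<le> e * card (cube n)"
      by (simp add: mult_ac)
    have "card (A - B) \<le> card (L \<union> irregular n R f \<eta>)"
      using fA fi by (intro card_mono) (auto simp: B_def L_def)
    also have "\<dots> \<le> card L + card (irregular n R f \<eta>)"
      by (rule card_Un_le)
    finally have "real (card (A - B)) \<le> real (card L) + real (card (irregular n R f \<eta>))"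
      by (simp only: of_nat_add[symmetric] of_nat_le_iff)
    then have small: "real (card (A - B)) \<le> \<epsilon> * card (cube n)"
      using L irr by (simp add: e_def)
    have "x + y \<notin> B" if xy: "x \<in> B" "y \<in> B" for x y
    proof
      assume z: "x + y \<in> B"
      let ?h = "real (card (atom n R (0\<^sub>v n)))"
      have xc: "x \<in> cube n" "y \<in> cube n"
        using xy A by (auto simp: B_def)
      have "(e ^ 3 - 2 * \<eta>) * ?h\<^sup>2 \<le> (\<Sum>u\<in>cube n. \<Sum>v\<in>cube n. f u * f v * f (u + v))"
        by (rule counting[OF R(1) xc e \<eta> f]) (use xy z in \<open>auto simp: B_def\<close>)
      also have "\<dots> = (\<Sum>(u, v)\<in>cube n \<times> cube n. f u * f v * f (u + v))"
        by (rule sum.cartesian_product)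
      also have "\<dots> = (\<Sum>p\<in>cube n \<times> cube n. if (\<lambda>(x, y). x \<in> A \<and> y \<in> A \<and> x + y \<in> A) p then 1 else 0)"
        by (intro sum.cong refl) (auto simp: f_def split: if_splits)
      also have "\<dots> = (\<Sum>p\<in>{p\<in>cube n \<times> cube n. (\<lambda>(x, y). x \<in> A \<and> y \<in> A \<and> x + y \<in> A) p}. 1)"
        by (rule sum.inter_filter[symmetric]) simp
      also have "{p\<in>cube n \<times> cube n. (\<lambda>(x, y). x \<in> A \<and> y \<in> A \<and> x + y \<in> A) p}
        = {(x, y)\<in>cube n \<times> cube n. x \<in> A \<and> y \<in> A \<and> x + y \<in> A}"
        by auto
      finally have "(e ^ 3 / 2) * ?h\<^sup>2 < \<delta> * (real (card (cube n)))\<^sup>2"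
        using few by (simp add: \<eta>_def)
      moreover have "\<delta> * (real (card (cube n)))\<^sup>2 \<le> \<delta> * (2 ^ K * ?h)\<^sup>2"
      proof (intro mult_left_mono power_mono)
        have "card (cube n) \<le> 2 ^ K * card (atom n R (0\<^sub>v n))"
          using card_cube_le[OF R(1)] power_increasing[OF R(2), of "2::nat"]
          by (meson le_trans mult_le_mono1 one_le_numeral)
        then have "real (card (cube n)) \<le> real (2 ^ K * card (atom n R (0\<^sub>v n)))"
          by (simp only: of_nat_le_iff)
        then show "real (card (cube n)) \<le> 2 ^ K * ?h"
          by simp
      qed (use \<open>\<delta> > 0\<close> in auto)
      moreover have "\<delta> * (2 ^ K * ?h)\<^sup>2 = (e ^ 3 / 2) * ?h\<^sup>2"
        by (simp add: \<delta>_def power_mult_distrib)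
      ultimately show False
        by simp
    qed
    then have "\<forall>x\<in>B. \<forall>y\<in>B. x + y \<notin> B"
      by blast
    moreover have "B \<subseteq> A"
      by (auto simp: B_def)
    ultimately show ?thesis
      using small by blast
  qed
  show ?thesis
    by (intro exI[of _ \<delta>] conjI allI impI) (fact \<open>\<delta> > 0\<close>, rule removal)
qed

section \<open>Testing nonlinear triangle-freeness\<close>

lemma card_cube: "card (cube n) = 2 ^ n"
proof -
  have "bij_betw (\<lambda>v. restrict (vec_index v) {..<n}) (cube n) ({..<n} \<rightarrow>\<^sub>E (UNIV :: bit set))"
  proof (rule bij_betwI[where g = "vec n"])
    show "restrict (vec_index (vec n c)) {..<n} = c" if "c \<in> {..<n} \<rightarrow>\<^sub>E (UNIV :: bit set)" for c
      using that by (auto simp: fun_eq_iff PiE_def extensional_def)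
    show "vec n (restrict (vec_index v) {..<n}) = v" if "v \<in> cube n" for v
      using that by (intro eq_vecI) auto
  qed auto
  then have "card (cube n) = card ({..<n} \<rightarrow>\<^sub>E (UNIV :: bit set))"
    by (rule bij_betw_same_card)
  then show ?thesis
    by (simp add: card_PiE card_UNIV_bit)
qed

lemma ex_cube_outside:
  assumes "finite X" "card X < 2 ^ n"
  obtains y where "y \<in> cube n" "y \<notin> X"
proof -
  have "\<not> cube n \<subseteq> X"
    using card_mono[OF assms(1), of "cube n"] assms(2) by (auto simp: card_cube)
  then show ?thesis
    using that by blast
qed

section \<open>Nonlinear triangle-free functions near a given triangle-free one\<close>

lemma triangle_freeD:
  "f \<in> triangle_free n \<Longrightarrow> x \<in> cube n \<Longrightarrow> y \<in> cube n \<Longrightarrow> f x = 1 \<Longrightarrow> f y = 1 \<Longrightarrow> f (x + y) \<noteq> 1"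
  unfolding triangle_free_def mem_Collect_eq prod.inject by blast

lemma triangle_freeI:
  assumes "f \<in> boolfuns n"
    and "\<And>x y. x \<in> cube n \<Longrightarrow> y \<in> cube n \<Longrightarrow> f x = 1 \<Longrightarrow> f y = 1 \<Longrightarrow> f (x + y) = 1 \<Longrightarrow> False"
  shows "f \<in> triangle_free n"
  using assms unfolding triangle_free_def mem_Collect_eq prod.inject by blast

lemma triangle_free_near_NLTF:
  assumes n: "n \<ge> 2" and g: "g \<in> triangle_free n"
  obtains h where "h \<in> NLTF n" "card {x\<in>cube n. g x \<noteq> h x} \<le> 1"
proof (cases "g \<in> LIN n")
  case False
  then show ?thesis
    using that[of g] g by (simp add: NLTF_def)
next
  case True
  have four: "4 \<le> (2::nat) ^ n"
    using power_increasing[OF n, of "2::nat"] by simp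
  have lin: "g (x + y) = g x + g y" if "x \<in> cube n" "y \<in> cube n" for x y
    using True that by (simp add: LIN_def)
  have gb: "g \<in> boolfuns n"
    using g by (simp add: triangle_free_def)
  have g0: "g (0\<^sub>v n) \<noteq> 1"
  proof
    assume "g (0\<^sub>v n) = 1"
    then show False
      using triangle_freeD[OF g, of "0\<^sub>v n" "0\<^sub>v n"] by simp
  qed
  \<comment> \<open>One flip at \<open>x0\<close> serves both cases: if \<open>g\<close> takes the
    value 1, it does so at \<open>x0\<close>, which is nonzero because of \<open>g0\<close>;
    otherwise \<open>x0\<close> is any nonzero point.\<close>
  obtain x0 where x0: "x0 \<in> cube n" "x0 \<noteq> 0\<^sub>v n" "(\<exists>x\<in>cube n. g x = 1) \<longrightarrow> g x0 = 1"
  proof (cases "\<exists>x\<in>cube n. g x = 1")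
    case True
    then show ?thesis
      using that g0 by metis
  next
    case False
    then show ?thesis
      using that ex_cube_outside[of "{0\<^sub>v n}" n] four by auto
  qed
  \<comment> \<open>Here dimension at least 2 enters: there is a third point \<open>y\<close>. The
    flip changes neither \<open>y\<close> nor \<open>x0 + y\<close>, whose sum is \<open>x0\<close>,
    so linearity after the flip would restore the old value at \<open>x0\<close>.\<close>
  have "card {0\<^sub>v n, x0} \<le> 2"
    by (simp add: card_insert_if)
  then obtain y where y: "y \<in> cube n" "y \<notin> {0\<^sub>v n, x0}"
    using ex_cube_outside[of "{0\<^sub>v n, x0}" n] four by auto
  define h where "h = g(x0 := g x0 + 1)"
  have hb: "h \<in> boolfuns n"
    using gb x0(1) by (auto simp: h_def boolfuns_def PiE_def extensional_def)
  have "h \<in> triangle_free n"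
  proof (rule triangle_freeI[OF hb])
    fix x z assume xz: "x \<in> cube n" "z \<in> cube n" "h x = 1" "h z = 1" "h (x + z) = 1"
    show False
    proof (cases "g x0 = 1")
      case True
      then have "h u = 1 \<Longrightarrow> g u = 1" for u
        by (auto simp: h_def split: if_splits)
      then show False
        using triangle_freeD[OF g xz(1,2)] xz(3-5) by blast
    next
      case False
      then have only: "h u = 1 \<Longrightarrow> u = x0" if "u \<in> cube n" for u
        using x0(3) that by (auto simp: h_def split: if_splits)
      have "x = x0" "z = x0" "x + z = x0"
        by (rule only[OF _ xz(3)] only[OF _ xz(4)] only[OF _ xz(5)], simp add: xz(1,2))+
      then show False
        using x0 cube_add_self[OF x0(1)] by simp
    qed
  qed
  moreover have "h \<notin> LIN n"
  proof
    assume "h \<in> LIN n"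
    moreover have xy: "x0 + y \<in> cube n"
      using x0 y by simp
    ultimately have "h y + h (x0 + y) = h (y + (x0 + y))"
      using y by (simp add: LIN_def)
    moreover have e: "y + (x0 + y) = x0"
      using x0 y cube_add_left_cancel[of y n x0] comm_add_vec[of x0 n y] by simp
    moreover have "x0 + y \<noteq> x0"
    proof
      assume "x0 + y = x0"
      then have "y = x0 + x0"
        using cube_add_left_cancel[OF x0(1) y(1)] by simp
      then show False
        using y cube_add_self[OF x0(1)] by simp
    qed
    ultimately have "g y + g (x0 + y) = g x0 + 1"
      using y by (simp add: h_def)
    moreover have "g y + g (x0 + y) = g x0"
      using lin[OF y(1) xy] e by simp
    ultimately have "g x0 + 0 = g x0 + 1"
      by (metis add.right_neutral)
    then show False
      by (simp only: add_left_cancel) simp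
  qed
  moreover have "card {x\<in>cube n. g x \<noteq> h x} \<le> card {x0}"
    by (rule card_mono) (auto simp: h_def)
  ultimately show ?thesis
    using that[of h] by (simp add: NLTF_def)
qed

lemma property_dist_NLTF_le:
  assumes n: "n \<ge> 2" and g: "g \<in> triangle_free n"
  shows "property_dist n f (NLTF n) \<le> ereal (fun_dist n f g + 1 / card (cube n))"
proof -
  obtain h where h: "h \<in> NLTF n" "card {x\<in>cube n. g x \<noteq> h x} \<le> 1"
    by (rule triangle_free_near_NLTF[OF n g])
  have "card {x\<in>cube n. f x \<noteq> h x} \<le> card ({x\<in>cube n. f x \<noteq> g x} \<union> {x\<in>cube n. g x \<noteq> h x})"
    by (rule card_mono) auto
  also have "\<dots> \<le> card {x\<in>cube n. f x \<noteq> g x} + card {x\<in>cube n. g x \<noteq> h x}"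
    by (rule card_Un_le)
  finally have "card {x\<in>cube n. f x \<noteq> h x} \<le> card {x\<in>cube n. f x \<noteq> g x} + 1"
    using h(2) by simp
  then have "real (card {x\<in>cube n. f x \<noteq> h x}) \<le> real (card {x\<in>cube n. f x \<noteq> g x}) + 1"
    by linarith
  then have "fun_dist n f h \<le> fun_dist n f g + 1 / card (cube n)"
    unfolding fun_dist_eq_card add_divide_distrib[symmetric] by (rule divide_right_mono) simp
  then have "ereal (fun_dist n f h) \<le> ereal (fun_dist n f g + 1 / card (cube n))"
    by simp
  moreover have "property_dist n f (NLTF n) \<le> ereal (fun_dist n f h)"
    unfolding property_dist_def by (rule INF_lower[OF h(1)])
  ultimately show ?thesis
    by (rule order_trans[rotated])
qed

definition triangles :: "nat \<Rightarrow> boolfun \<Rightarrow> (bit vec \<times> bit vec) set" where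
  "triangles n f = {(x, y)\<in>cube n \<times> cube n. f x = 1 \<and> f y = 1 \<and> f (x + y) = 1}"

lemma triangles_subset: "triangles n f \<subseteq> cube n \<times> cube n"
  by (auto simp: triangles_def)

text \<open>The distance is spent in two halves: removal with \<open>\<epsilon> / 2\<close> leads to
  a triangle-free function, and the one further point that leads into \<open>NLTF\<close> costs
  \<open>1 / 2 ^ n\<close>, which is less than \<open>\<epsilon> / 2\<close>.\<close>

lemma far_imp_many_triangles:
  fixes \<epsilon> :: real
  assumes \<epsilon>: "\<epsilon> > 0"
  shows "\<exists>\<delta>>0. \<forall>n f. n \<ge> 2 \<longrightarrow> 2 / 2 ^ n < \<epsilon> \<longrightarrow> f \<in> boolfuns n \<longrightarrow>
    ereal \<epsilon> \<le> property_dist n f (NLTF n) \<longrightarrow> \<delta> * (real (card (cube n)))\<^sup>2 \<le> real (card (triangles n f))"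
proof -
  obtain \<delta> where "\<delta> > 0" and \<delta>: "\<forall>n. \<forall>A\<subseteq>cube n.
    real (card {(x, y)\<in>cube n \<times> cube n. x \<in> A \<and> y \<in> A \<and> x + y \<in> A}) < \<delta> * (real (card (cube n)))\<^sup>2 \<longrightarrow>
    (\<exists>B\<subseteq>A. real (card (A - B)) \<le> \<epsilon> / 2 * card (cube n) \<and> (\<forall>x\<in>B. \<forall>y\<in>B. x + y \<notin> B))"
    using triangle_removal[OF half_gt_zero[OF \<epsilon>]] by (elim exE conjE) (rule that)
  have many: "\<delta> * (real (card (cube n)))\<^sup>2 \<le> real (card (triangles n f))"
    if n: "n \<ge> 2" "2 / 2 ^ n < \<epsilon>" and f: "f \<in> boolfuns n" and far: "ereal \<epsilon> \<le> property_dist n f (NLTF n)"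
    for n f
  proof (rule ccontr)
    assume few: "\<not> ?thesis"
    define A where "A = {x\<in>cube n. f x = 1}"
    have tri: "{(x, y)\<in>cube n \<times> cube n. x \<in> A \<and> y \<in> A \<and> x + y \<in> A} = triangles n f"
      by (auto simp: A_def triangles_def)
    have AV: "A \<subseteq> cube n"
      by (auto simp: A_def)
    have "real (card {(x, y)\<in>cube n \<times> cube n. x \<in> A \<and> y \<in> A \<and> x + y \<in> A}) < \<delta> * (real (card (cube n)))\<^sup>2"
      unfolding tri using few by (simp only: not_le)
    then have "\<exists>B\<subseteq>A. real (card (A - B)) \<le> \<epsilon> / 2 * card (cube n) \<and> (\<forall>x\<in>B. \<forall>y\<in>B. x + y \<notin> B)"
      by (rule \<delta>[THEN spec, of n, THEN spec, of A, THEN mp, OF AV, THEN mp])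
    then obtain B where B: "B \<subseteq> A" "real (card (A - B)) \<le> \<epsilon> / 2 * card (cube n)"
      "\<forall>x\<in>B. \<forall>y\<in>B. x + y \<notin> B"
      by blast
    define g where "g = (\<lambda>x\<in>cube n. if x \<in> B then 1 else 0 :: bit)"
    have "g \<in> boolfuns n"
      by (simp add: g_def boolfuns_def)
    then have g: "g \<in> triangle_free n"
      by (rule triangle_freeI) (use B in \<open>auto simp: g_def split: if_splits\<close>)
    have "{x\<in>cube n. f x \<noteq> g x} \<subseteq> A - B"
      using B(1) by (auto simp: g_def A_def split: if_splits)
    then have "card {x\<in>cube n. f x \<noteq> g x} \<le> card (A - B)"
      by (intro card_mono) (auto simp: A_def)
    then have "real (card {x\<in>cube n. f x \<noteq> g x}) \<le> \<epsilon> / 2 * card (cube n)"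
      using B(2) by linarith
    then have "fun_dist n f g \<le> \<epsilon> / 2"
      unfolding fun_dist_eq_card by (subst pos_divide_le_eq) (simp_all add: card_cube_pos)
    moreover have "1 / real (card (cube n)) < \<epsilon> / 2"
      using n(2) by (simp add: card_cube)
    ultimately have "fun_dist n f g + 1 / card (cube n) < \<epsilon>"
      by simp
    moreover have "ereal \<epsilon> \<le> ereal (fun_dist n f g + 1 / card (cube n))"
      using far property_dist_NLTF_le[OF n(1) g] by (rule order_trans)
    ultimately show False
      by simp
  qed
  show ?thesis
    by (intro exI[of _ \<delta>] conjI allI impI) (fact \<open>\<delta> > 0\<close>, rule many)
qed

section \<open>Sampling and exhaustive query algorithms\<close>

primrec triangle_test :: "(bit vec \<times> bit vec) list \<Rightarrow> query_tree" where
  "triangle_test [] = Halt True"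
| "triangle_test (p # ps) = Query (fst p) (\<lambda>a. Query (snd p) (\<lambda>b. Query (fst p + snd p) (\<lambda>c.
     if a = 1 \<and> b = 1 \<and> c = 1 then Halt False else triangle_test ps)))"

lemma accepts_triangle_test:
  "accepts (triangle_test ps) f \<longleftrightarrow>
    (\<forall>p\<in>set ps. \<not> (f (fst p) = 1 \<and> f (snd p) = 1 \<and> f (fst p + snd p) = 1))"
  by (induction ps) auto

lemma queries_triangle_test:
  assumes "set ps \<subseteq> cube n \<times> cube n"
  shows "set (queries (triangle_test ps) f) \<subseteq> cube n"
    and "length (queries (triangle_test ps) f) \<le> 3 * length ps"
  using assms by (induction ps) auto

lemma accept_prob_map_pmf_of_set:
  assumes "finite \<Omega>" "\<Omega> \<noteq> {}"
  shows "accept_prob (map_pmf t (pmf_of_set \<Omega>)) f = card {\<omega>\<in>\<Omega>. accepts (t \<omega>) f} / card \<Omega>"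
  using assms by (simp add: accept_prob_def measure_pmf_of_set vimage_def Int_def)

text \<open>Independent samples are encoded as one uniformly random list of \<open>K\<close> pairs.
  The accepting lists are those that avoid \<open>triangles n f\<close>, so the acceptance
  probability is a \<open>K\<close>-th power.\<close>

lemma sampling_tester:
  fixes \<delta> \<epsilon> :: real
  assumes \<delta>: "\<delta> > 0" and K: "(1 - \<delta>) ^ K \<le> 1 / 3" and P: "P n \<subseteq> triangle_free n"
    and far: "\<And>f. f \<in> boolfuns n \<Longrightarrow> ereal \<epsilon> \<le> property_dist n f (P n) \<Longrightarrow>
      \<delta> * (real (card (cube n)))\<^sup>2 \<le> real (card (triangles n f))"
  shows "\<exists>T. one_sided_tester P n \<epsilon> T \<and> max_queries n T (3 * K)"
proof -
  let ?S = "cube n \<times> cube n"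
  define \<Omega> where "\<Omega> = {ps. set ps \<subseteq> ?S \<and> length ps = K}"
  have fin: "finite \<Omega>"
    unfolding \<Omega>_def by (rule finite_lists_length_eq) simp
  have "replicate K (0\<^sub>v n, 0\<^sub>v n) \<in> \<Omega>"
    by (simp add: \<Omega>_def set_replicate_conv_if)
  then have ne: "\<Omega> \<noteq> {}"
    by blast
  define T where "T = map_pmf triangle_test (pmf_of_set \<Omega>)"
  have set_T: "set_pmf T = triangle_test ` \<Omega>"
    using fin ne by (simp add: T_def)
  have prob: "accept_prob T f = card {ps\<in>\<Omega>. accepts (triangle_test ps) f} / card \<Omega>" for f
    unfolding T_def by (rule accept_prob_map_pmf_of_set[OF fin ne])
  have "accept_prob T f = 1" if f: "f \<in> P n" for f
  proof -
    have "{ps\<in>\<Omega>. accepts (triangle_test ps) f} = \<Omega>"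
      using P f by (fastforce simp: accepts_triangle_test \<Omega>_def dest: triangle_freeD)
    then show ?thesis
      using fin ne by (simp add: prob)
  qed
  moreover have "accept_prob T f \<le> 1 / 3" if f: "f \<in> boolfuns n" and d: "ereal \<epsilon> \<le> property_dist n f (P n)" for f
  proof -
    have fT: "finite (triangles n f)"
      by (rule finite_subset[OF triangles_subset]) simp
    have "{ps\<in>\<Omega>. accepts (triangle_test ps) f} = {ps. set ps \<subseteq> ?S - triangles n f \<and> length ps = K}"
      by (fastforce simp: accepts_triangle_test \<Omega>_def triangles_def)
    then have "card {ps\<in>\<Omega>. accepts (triangle_test ps) f} = card (?S - triangles n f) ^ K"
      by (simp add: card_lists_length_eq)
    moreover have "card \<Omega> = card ?S ^ K"
      unfolding \<Omega>_def by (rule card_lists_length_eq) simp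
    ultimately have "accept_prob T f = (real (card (?S - triangles n f)) / real (card ?S)) ^ K"
      by (simp add: prob power_divide)
    also have "\<dots> \<le> (1 - \<delta>) ^ K"
    proof (rule power_mono)
      have c: "real (card ?S) = (real (card (cube n)))\<^sup>2"
        by (simp add: power2_eq_square card_cartesian_product)
      have S0: "real (card ?S) > 0"
        unfolding c by (simp add: card_cube)
      have "card (?S - triangles n f) = card ?S - card (triangles n f)"
        by (rule card_Diff_subset[OF fT triangles_subset])
      moreover have "card (triangles n f) \<le> card ?S"
        by (rule card_mono[OF _ triangles_subset]) simp
      ultimately have "real (card (?S - triangles n f)) \<le> (1 - \<delta>) * real (card ?S)"
        using far[OF f d] c by (simp add: of_nat_diff left_diff_distrib)
      then show "real (card (?S - triangles n f)) / real (card ?S) \<le> 1 - \<delta>"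
        using S0 by (simp only: pos_divide_le_eq)
    qed simp
    finally show ?thesis
      using K by simp
  qed
  moreover have "set (queries t f) \<subseteq> cube n" "length (queries t f) \<le> 3 * K" if t: "t \<in> set_pmf T" for t f
  proof -
    obtain ps where "ps \<in> \<Omega>" "t = triangle_test ps"
      using t unfolding set_T by blast
    then show "set (queries t f) \<subseteq> cube n" "length (queries t f) \<le> 3 * K"
      using queries_triangle_test[of ps n f] by (simp_all add: \<Omega>_def)
  qed
  ultimately show ?thesis
    by (intro exI[of _ T]) (simp add: one_sided_tester_def max_queries_def)
qed

primrec query_all :: "bit vec list \<Rightarrow> (bit list \<Rightarrow> bool) \<Rightarrow> query_tree" where
  "query_all [] D = Halt (D [])"
| "query_all (x # xs) D = Query x (\<lambda>b. query_all xs (\<lambda>bs. D (b # bs)))"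

lemma accepts_query_all: "accepts (query_all xs D) f = D (map f xs)"
  by (induction xs arbitrary: D) auto

lemma queries_query_all: "queries (query_all xs D) f = xs"
  by (induction xs arbitrary: D) auto

text \<open>Membership is decided exactly, and members have distance 0, which is below
  \<open>\<epsilon>\<close>. If \<open>P n\<close> is empty, all functions are at infinite distance,
  and all are rejected.\<close>

lemma exhaustive_tester:
  fixes \<epsilon> :: real
  assumes "P n \<subseteq> boolfuns n" "\<epsilon> > 0"
  shows "\<exists>T. one_sided_tester P n \<epsilon> T \<and> max_queries n T (2 ^ n)"
proof -
  obtain xs where xs: "set xs = cube n" "distinct xs"
    using finite_distinct_list[OF finite_cube[of n]] by blast
  define t where "t = query_all xs (\<lambda>bs. \<exists>g\<in>P n. map g xs = bs)"
  have eq: "f = g" if "f \<in> boolfuns n" "g \<in> boolfuns n" "map g xs = map f xs" for f g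
  proof (rule PiE_ext[of _ "cube n" "\<lambda>_. UNIV"])
    show "f x = g x" if "x \<in> cube n" for x
      using that \<open>map g xs = map f xs\<close> xs(1) by (metis map_eq_conv)
  qed (use that in \<open>simp_all add: boolfuns_def\<close>)
  have acc: "accepts t f \<longleftrightarrow> f \<in> P n" if "f \<in> boolfuns n" for f
    unfolding t_def accepts_query_all using eq[OF that] assms(1) by blast
  have prob: "accept_prob (return_pmf t) f = (if f \<in> P n then 1 else 0)" if "f \<in> boolfuns n" for f
    using acc[OF that] by (simp add: accept_prob_def indicator_def)
  have "f \<notin> P n" if "ereal \<epsilon> \<le> property_dist n f (P n)" for f
  proof
    assume "f \<in> P n"
    then have "property_dist n f (P n) \<le> ereal (fun_dist n f f)"
      unfolding property_dist_def by (rule INF_lower)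
    then have "ereal \<epsilon> \<le> ereal (fun_dist n f f)"
      by (rule order_trans[OF that])
    then show False
      using assms(2) by (simp add: fun_dist_def)
  qed
  moreover have "length xs = 2 ^ n"
    using xs distinct_card[of xs] by (simp add: card_cube)
  ultimately have "one_sided_tester P n \<epsilon> (return_pmf t) \<and> max_queries n (return_pmf t) (2 ^ n)"
    using assms(1) xs(1) prob
    by (auto simp: one_sided_tester_def max_queries_def t_def queries_query_all)
  then show ?thesis ..
qed

lemma max_queries_mono: "max_queries n T q \<Longrightarrow> q \<le> q' \<Longrightarrow> max_queries n T q'"
  by (auto simp: max_queries_def intro: order_trans)

lemma NLTF_testable: "one_sided_testable NLTF"
proof -
  have "\<exists>q. \<forall>n. \<exists>T. one_sided_tester NLTF n \<epsilon> T \<and> max_queries n T q" if \<epsilon>: "\<epsilon> > 0" for \<epsilon>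
  proof -
    obtain \<delta> where "\<delta> > 0" and \<delta>: "\<forall>n f. n \<ge> 2 \<longrightarrow> 2 / 2 ^ n < \<epsilon> \<longrightarrow> f \<in> boolfuns n \<longrightarrow>
      ereal \<epsilon> \<le> property_dist n f (NLTF n) \<longrightarrow> \<delta> * (real (card (cube n)))\<^sup>2 \<le> real (card (triangles n f))"
      using far_imp_many_triangles[OF \<epsilon>] by (elim exE conjE) (rule that)
    define \<delta>' where "\<delta>' = min \<delta> (1 / 2)"
    have \<delta>': "\<delta>' > 0" "\<delta>' \<le> \<delta>" "\<delta>' < 1"
      using \<open>\<delta> > 0\<close> by (auto simp: \<delta>'_def)
    obtain K where K: "(1 - \<delta>') ^ K < 1 / 3"
      using real_arch_pow_inv[of "1 / 3" "1 - \<delta>'"] \<delta>' by auto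
    \<comment> \<open>The terms serve, in this order, the sampling test, the dimensions 0 and 1, and
      the larger dimensions with \<open>2 ^ n \<le> 2 / \<epsilon>\<close>.\<close>
    define q where "q = max (3 * K) (max 2 (nat \<lceil>2 / \<epsilon>\<rceil>))"
    have "\<exists>T. one_sided_tester NLTF n \<epsilon> T \<and> max_queries n T q" for n
    proof (cases "n \<ge> 2 \<and> 2 / 2 ^ n < \<epsilon>")
      case True
      have "\<delta>' * (real (card (cube n)))\<^sup>2 \<le> real (card (triangles n f))"
        if "f \<in> boolfuns n" "ereal \<epsilon> \<le> property_dist n f (NLTF n)" for f
      proof -
        have "\<delta>' * (real (card (cube n)))\<^sup>2 \<le> \<delta> * (real (card (cube n)))\<^sup>2"
          using \<delta>'(2) by (rule mult_right_mono) simp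
        then show ?thesis
          using \<delta>[rule_format, of n f] True that by linarith
      qed
      then have "\<exists>T. one_sided_tester NLTF n \<epsilon> T \<and> max_queries n T (3 * K)"
        using sampling_tester[of \<delta>' K NLTF n \<epsilon>] \<delta>'(1) K by (auto simp: NLTF_def)
      moreover have "3 * K \<le> q"
        by (simp add: q_def)
      ultimately show ?thesis
        by (blast intro: max_queries_mono)
    next
      case False
      have "2 ^ n \<le> q"
      proof (cases "n \<ge> 2")
        case True
        then have "2 ^ n \<le> 2 / \<epsilon>"
          using False \<epsilon> by (simp add: field_simps)
        then have "2 ^ n \<le> nat \<lceil>2 / \<epsilon>\<rceil>"
          by (simp add: le_nat_iff le_ceiling_iff)
        then show ?thesis
          by (simp only: q_def le_max_iff_disj simp_thms)
      next
        case False
        then have "n = 0 \<or> n = 1"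
          by auto
        then have "(2::nat) ^ n \<le> 2"
          by auto
        then show ?thesis
          by (simp add: q_def)
      qed
      moreover have "NLTF n \<subseteq> boolfuns n"
        by (auto simp: NLTF_def triangle_free_def)
      ultimately show ?thesis
        using exhaustive_tester[of NLTF n \<epsilon>] \<epsilon> by (blast intro: max_queries_mono)
    qed
    then show ?thesis
      by blast
  qed
  then obtain q where q: "\<And>\<epsilon> n. \<epsilon> > 0 \<Longrightarrow> \<exists>T. one_sided_tester NLTF n \<epsilon> T \<and> max_queries n T (q \<epsilon>)"
    by metis
  then obtain T where "\<And>\<epsilon> n. \<epsilon> > 0 \<Longrightarrow> one_sided_tester NLTF n \<epsilon> (T \<epsilon> n) \<and> max_queries n (T \<epsilon> n) (q \<epsilon>)"
    by metis
  then show ?thesis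
    unfolding one_sided_testable_def one_sided_tester_family_def by blast
qed

section \<open>Random linear images of a triangle-sparse set\<close>

lemma ex_scalar_prod_ne_0:
  assumes "x \<in> cube n" "x \<noteq> 0\<^sub>v n"
  obtains z where "z \<in> cube n" "scalar_prod x z \<noteq> 0"
proof -
  obtain i where i: "i < n" "vec_index x i \<noteq> 0"
    using assms eq_vecI[of x "0\<^sub>v n"] by (auto simp del: bit_not_zero_iff)
  show ?thesis
    using that[of "unit_vec n i"] i assms(1) by simp
qed

lemma scalar_prod_add_right:
  "r \<in> cube n \<Longrightarrow> x \<in> cube n \<Longrightarrow> y \<in> cube n \<Longrightarrow> scalar_prod r (x + y) = scalar_prod r x + scalar_prod r y"
  by (rule scalar_prod_add_distrib)

lemma sum_sg_additive:
  assumes add: "\<And>x y. x \<in> cube n \<Longrightarrow> y \<in> cube n \<Longrightarrow> g (x + y) = g x + g y"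
    and a: "a \<in> cube n" "g a \<noteq> 0"
  shows "(\<Sum>x\<in>cube n. sg (g x)) = 0"
proof -
  have "(\<Sum>x\<in>cube n. sg (g x)) = (\<Sum>x\<in>cube n. sg (g (a + x)))"
    using sum.reindex_bij_betw[OF bij_betw_cube_add[OF a(1)], of "\<lambda>x. sg (g x)"] by (rule sym)
  also have "\<dots> = (\<Sum>x\<in>cube n. - sg (g x))"
  proof (rule sum.cong[OF refl])
    fix x assume x: "x \<in> cube n"
    have "sg (g (a + x)) = sg (g a) * sg (g x)"
      unfolding add[OF a(1) x] by (rule sg_add)
    then show "sg (g (a + x)) = - sg (g x)"
      using a(2) by (simp add: sg_def)
  qed
  finally show ?thesis
    by (simp add: sum_negf)
qed

text \<open>Linear independence over F_2: coefficients are 0 or 1, so linear combinations are subset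
  sums, and such a sum is nonzero iff it pairs nontrivially with some point. Since the family is
  indexed, a repeated row counts as a dependence.\<close>

definition independent_rows :: "nat \<Rightarrow> 'i set \<Rightarrow> ('i \<Rightarrow> bit vec) \<Rightarrow> bool" where
  "independent_rows n I P \<longleftrightarrow> (\<forall>S\<subseteq>I. S \<noteq> {} \<longrightarrow> (\<exists>x\<in>cube n. (\<Sum>i\<in>S. scalar_prod (P i) x) \<noteq> 0))"

text \<open>The indicator of the solutions times \<open>2 ^ card I\<close> is the product of the
  terms \<open>1 + sg\<close>. Expanded over subsets of \<open>I\<close>, every nonempty subset
  contributes a nontrivial character, which sums to 0.\<close>

lemma card_solutions:
  assumes I: "finite I" and P: "\<And>i. i \<in> I \<Longrightarrow> P i \<in> cube n" and ind: "independent_rows n I P"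
  shows "card {x\<in>cube n. \<forall>i\<in>I. scalar_prod (P i) x = c i} * 2 ^ card I = card (cube n)"
proof -
  have "real (card {x\<in>cube n. \<forall>i\<in>I. scalar_prod (P i) x = c i} * 2 ^ card I)
    = (\<Sum>x\<in>{x\<in>cube n. \<forall>i\<in>I. scalar_prod (P i) x = c i}. 2 ^ card I)"
    by simp
  also have "\<dots> = (\<Sum>x\<in>cube n. if \<forall>i\<in>I. scalar_prod (P i) x = c i then 2 ^ card I else 0)"
    by (rule sum.inter_filter) simp
  also have "\<dots> = (\<Sum>x\<in>cube n. \<Prod>i\<in>I. sg (scalar_prod (P i) x + c i) + 1)"
  proof (rule sum.cong[OF refl])
    fix x assume "x \<in> cube n"
    show "(if \<forall>i\<in>I. scalar_prod (P i) x = c i then 2 ^ card I else 0)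
      = (\<Prod>i\<in>I. sg (scalar_prod (P i) x + c i) + 1)"
    proof (cases "\<forall>i\<in>I. scalar_prod (P i) x = c i")
      case True
      then have "(\<Prod>i\<in>I. sg (scalar_prod (P i) x + c i) + 1) = (\<Prod>i\<in>I. 2)"
        by (intro prod.cong refl) (simp add: sg_def)
      then show ?thesis
        using True by simp
    next
      case False
      then obtain i where i: "i \<in> I" "scalar_prod (P i) x \<noteq> c i"
        by blast
      then have "sg (scalar_prod (P i) x + c i) + 1 = 0"
        by (cases "scalar_prod (P i) x"; cases "c i") (simp_all add: sg_def)
      then have "(\<Prod>i\<in>I. sg (scalar_prod (P i) x + c i) + 1) = 0"
        using i(1) I by (intro prod_zero) blast+
      then show ?thesis
        using False by simp
    qed
  qed
  also have "\<dots> = (\<Sum>x\<in>cube n. \<Sum>S\<in>Pow I. \<Prod>i\<in>S. sg (scalar_prod (P i) x + c i))"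
    by (simp add: prod_add[OF I])
  also have "\<dots> = (\<Sum>S\<in>Pow I. \<Sum>x\<in>cube n. \<Prod>i\<in>S. sg (scalar_prod (P i) x + c i))"
    by (rule sum.swap)
  also have "\<dots> = (\<Sum>S\<in>Pow I. if S = {} then real (card (cube n)) else 0)"
  proof (rule sum.cong[OF refl])
    fix S assume "S \<in> Pow I"
    then have S: "S \<subseteq> I"
      by simp
    then have fS: "finite S"
      using I by (rule finite_subset)
    show "(\<Sum>x\<in>cube n. \<Prod>i\<in>S. sg (scalar_prod (P i) x + c i)) = (if S = {} then real (card (cube n)) else 0)"
    proof (cases "S = {}")
      case True
      then show ?thesis by simp
    next
      case False
      have "(\<Sum>x\<in>cube n. \<Prod>i\<in>S. sg (scalar_prod (P i) x + c i))
        = (\<Sum>x\<in>cube n. sg (\<Sum>i\<in>S. scalar_prod (P i) x) * (\<Prod>i\<in>S. sg (c i)))"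
        by (simp only: sg_add prod.distrib sg_sum[OF fS])
      also have "\<dots> = (\<Sum>x\<in>cube n. sg (\<Sum>i\<in>S. scalar_prod (P i) x)) * (\<Prod>i\<in>S. sg (c i))"
        by (rule sum_distrib_right[symmetric])
      also have "(\<Sum>x\<in>cube n. sg (\<Sum>i\<in>S. scalar_prod (P i) x)) = 0"
      proof -
        obtain a where a: "a \<in> cube n" "(\<Sum>i\<in>S. scalar_prod (P i) a) \<noteq> 0"
          using ind S False unfolding independent_rows_def by blast
        have "(\<Sum>i\<in>S. scalar_prod (P i) (x + y)) = (\<Sum>i\<in>S. scalar_prod (P i) x) + (\<Sum>i\<in>S. scalar_prod (P i) y)"
          if xy: "x \<in> cube n" "y \<in> cube n" for x y
        proof -
          have "(\<Sum>i\<in>S. scalar_prod (P i) (x + y)) = (\<Sum>i\<in>S. scalar_prod (P i) x + scalar_prod (P i) y)"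
            by (intro sum.cong refl scalar_prod_add_right[OF P xy]) (use S in blast)
          then show ?thesis
            by (simp only: sum.distrib)
        qed
        then show ?thesis
          using a by (rule sum_sg_additive)
      qed
      finally show ?thesis
        using False by simp
    qed
  qed
  also have "\<dots> = real (card (cube n))"
    using I by (simp add: sum.delta)
  finally show ?thesis
    by (simp only: of_nat_eq_iff)
qed

text \<open>If the rows in a nonempty \<open>S\<close> sum to 0, one of them is determined by the
  others, which has probability at most \<open>1 / 2 ^ n\<close>; then a union bound over the
  subsets.\<close>

lemma card_dependent_le:
  assumes I: "finite I"
  shows "card {P\<in>I \<rightarrow>\<^sub>E cube n. \<not> independent_rows n I P} * 2 ^ n \<le> 2 ^ card I * card (I \<rightarrow>\<^sub>E cube n)"
proof -
  define Z where "Z S = {P\<in>I \<rightarrow>\<^sub>E cube n. \<forall>x\<in>cube n. (\<Sum>i\<in>S. scalar_prod (P i) x) = 0}" for S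
  have fin: "finite (I \<rightarrow>\<^sub>E cube n)"
    using I by (intro finite_PiE) auto
  have Z: "card (Z S) * 2 ^ n \<le> card (I \<rightarrow>\<^sub>E cube n)" if S: "S \<subseteq> I" "S \<noteq> {}" for S
  proof -
    obtain i where i: "i \<in> S"
      using S by blast
    have fS: "finite S"
      using S(1) I by (rule finite_subset)
    have "inj_on (\<lambda>P. restrict P (I - {i})) (Z S)"
    proof (rule inj_onI)
      fix P Q assume PQ: "P \<in> Z S" "Q \<in> Z S" and e: "restrict P (I - {i}) = restrict Q (I - {i})"
      have eq: "P j = Q j" if "j \<in> I" "j \<noteq> i" for j
        using fun_cong[OF e, of j] that by simp
      have Pc: "P i \<in> cube n" "Q i \<in> cube n"
        using PQ i S by (auto simp: Z_def)
      have "scalar_prod (P i) x = scalar_prod (Q i) x" if x: "x \<in> cube n" for x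
      proof -
        have "(\<Sum>j\<in>S - {i}. scalar_prod (P j) x) = (\<Sum>j\<in>S - {i}. scalar_prod (Q j) x)"
          using eq S(1) by (intro sum.cong refl) (metis Diff_iff insertI1 subsetD)
        moreover have "scalar_prod (P i) x + (\<Sum>j\<in>S - {i}. scalar_prod (P j) x) = 0"
          "scalar_prod (Q i) x + (\<Sum>j\<in>S - {i}. scalar_prod (Q j) x) = 0"
          using PQ x sum.remove[OF fS i, of "\<lambda>j. scalar_prod (P j) x"]
            sum.remove[OF fS i, of "\<lambda>j. scalar_prod (Q j) x"] by (simp_all only: Z_def mem_Collect_eq)
        ultimately show ?thesis
          by (metis add_right_cancel)
      qed
      then have "vec_index (P i) k = vec_index (Q i) k" if "k < n" for k
        using that Pc scalar_prod_right_unit[OF that] by (metis unit_vec_carrier)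
      then have "P i = Q i"
        using Pc by (intro eq_vecI) auto
      then have "P j = Q j" if "j \<in> I" for j
        using eq that by metis
      then show "P = Q"
        using PQ by (intro PiE_ext[of P I "\<lambda>_. cube n" Q]) (auto simp: Z_def)
    qed
    moreover have "(\<lambda>P. restrict P (I - {i})) ` Z S \<subseteq> (I - {i}) \<rightarrow>\<^sub>E cube n"
      by (auto simp: Z_def split: if_splits)
    moreover have "finite ((I - {i}) \<rightarrow>\<^sub>E cube n)"
      using I by (intro finite_PiE) auto
    ultimately have "card (Z S) \<le> card ((I - {i}) \<rightarrow>\<^sub>E cube n)"
      by (rule card_inj_on_le)
    then have "card (Z S) * 2 ^ n \<le> (2 ^ n) ^ (card I - 1) * 2 ^ n"
      using I i S by (simp add: card_PiE card_cube card_Diff_singleton subsetD)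
    also have "\<dots> = (2 ^ n) ^ card I"
    proof -
      have "card I > 0"
        using I i S by (auto simp: card_gt_0_iff)
      then show ?thesis
        by (metis power_minus_mult)
    qed
    finally show ?thesis
      using I by (simp add: card_PiE card_cube)
  qed
  have "{P\<in>I \<rightarrow>\<^sub>E cube n. \<not> independent_rows n I P} \<subseteq> (\<Union>S\<in>Pow I - {{}}. Z S)"
    by (auto simp: independent_rows_def Z_def)
  then have "card {P\<in>I \<rightarrow>\<^sub>E cube n. \<not> independent_rows n I P} \<le> card (\<Union>S\<in>Pow I - {{}}. Z S)"
    by (rule card_mono[rotated]) (use I fin in \<open>auto simp: Z_def\<close>)
  also have "\<dots> \<le> (\<Sum>S\<in>Pow I - {{}}. card (Z S))"
    by (rule card_UN_le) (use I in auto)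
  finally have "card {P\<in>I \<rightarrow>\<^sub>E cube n. \<not> independent_rows n I P} * 2 ^ n \<le> (\<Sum>S\<in>Pow I - {{}}. card (Z S) * 2 ^ n)"
    by (simp add: sum_distrib_right[symmetric])
  also have "\<dots> \<le> (\<Sum>S\<in>Pow I - {{}}. card (I \<rightarrow>\<^sub>E cube n))"
    by (rule sum_mono) (use Z in auto)
  also have "\<dots> = card (Pow I - {{}}) * card (I \<rightarrow>\<^sub>E cube n)"
    by simp
  also have "\<dots> \<le> 2 ^ card I * card (I \<rightarrow>\<^sub>E cube n)"
  proof (rule mult_right_mono)
    have "card (Pow I - {{}}) \<le> card (Pow I)"
      using I by (intro card_mono) auto
    then show "card (Pow I - {{}}) \<le> 2 ^ card I"
      using I by (simp add: card_Pow)
  qed simp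
  finally show ?thesis .
qed

section \<open>Preimages of the triangle-sparse set under linear maps\<close>

abbreviation row_indices :: "nat \<Rightarrow> (nat \<times> bool) set" where
  "row_indices t \<equiv> {..<t} \<times> UNIV"

text \<open>The F_2^2-coordinate number \<open>j\<close> of the image of \<open>x\<close> under the
  linear map with rows \<open>P\<close>; the Boolean selects the row within the block.\<close>

definition block :: "(nat \<times> bool \<Rightarrow> bit vec) \<Rightarrow> bit vec \<Rightarrow> nat \<Rightarrow> bit \<times> bit" where
  "block P x j = (scalar_prod (P (j, False)) x, scalar_prod (P (j, True)) x)"

lemma UNIV_bit_pair: "(UNIV :: (bit \<times> bit) set) = {(0, 0), (0, 1), (1, 0), (1, 1)}"
proof -
  have "(UNIV :: (bit \<times> bit) set) = {0, 1} \<times> {0, 1}"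
    by (simp only: UNIV_bit[symmetric] UNIV_Times_UNIV)
  then show ?thesis
    by auto
qed

lemma card_UNIV_bit_pair: "card (UNIV :: (bit \<times> bit) set) = 4" "finite (UNIV :: (bit \<times> bit) set)"
  by (simp_all add: UNIV_bit_pair)

text \<open>Independent rows make the map onto, with all fibres of size
  \<open>2 ^ n / 4 ^ t\<close>, so blocks behave like independent uniform elements of F_2^2.\<close>

lemma card_blocks:
  assumes P: "P \<in> row_indices t \<rightarrow>\<^sub>E cube n" and ind: "independent_rows n (row_indices t) P"
  shows "card {x\<in>cube n. \<forall>j<t. block P x j \<in> B j} * 4 ^ t = 2 ^ n * (\<Prod>j<t. card (B j))"
proof -
  let ?X = "{x\<in>cube n. \<forall>j<t. block P x j \<in> B j}"
  let ?g = "\<lambda>x. restrict (block P x) {..<t}"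
  have finB: "finite (B j)" for j
    using card_UNIV_bit_pair(2) by (rule rev_finite_subset) simp
  have finP: "finite (PiE {..<t} B)"
    using finB by (auto intro!: finite_PiE)
  have sol: "card {x\<in>?X. ?g x = c} * 4 ^ t = 2 ^ n" if c: "c \<in> PiE {..<t} B" for c
  proof -
    let ?c = "\<lambda>i. if snd i then snd (c (fst i)) else fst (c (fst i))"
    have "x \<in> {x\<in>?X. ?g x = c} \<longleftrightarrow> x \<in> {x\<in>cube n. \<forall>i\<in>row_indices t. scalar_prod (P i) x = ?c i}" for x
    proof -
      have "?g x = c \<longleftrightarrow> (\<forall>j<t. block P x j = c j)"
        using c by (auto simp: fun_eq_iff PiE_def extensional_def)
      moreover have "(\<forall>j<t. block P x j = c j) \<longleftrightarrow> (\<forall>i\<in>row_indices t. scalar_prod (P i) x = ?c i)"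
        by (auto simp: block_def prod_eq_iff all_bool_eq)
      moreover have "(\<forall>j<t. block P x j = c j) \<Longrightarrow> (\<forall>j<t. block P x j \<in> B j)"
        using c by auto
      ultimately show ?thesis
        by blast
    qed
    then have "{x\<in>?X. ?g x = c} = {x\<in>cube n. \<forall>i\<in>row_indices t. scalar_prod (P i) x = ?c i}"
      by blast
    moreover have "card {x\<in>cube n. \<forall>i\<in>row_indices t. scalar_prod (P i) x = ?c i} * 2 ^ card (row_indices t) = card (cube n)"
      by (rule card_solutions[OF _ _ ind]) (use P in auto)
    moreover have "(2::nat) ^ card (row_indices t) = 4 ^ t"
      by (simp add: card_cartesian_product power_mult[symmetric] mult.commute[of t] power_mult)
    ultimately show ?thesis
      by (simp only: card_cube)
  qed
  have "card ?X * 4 ^ t = (\<Sum>x\<in>?X. 4 ^ t)"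
    by simp
  also have "\<dots> = (\<Sum>c\<in>PiE {..<t} B. \<Sum>x\<in>{x\<in>?X. ?g x = c}. 4 ^ t)"
    by (rule sum.group[symmetric]) (use finP in \<open>auto split: if_splits\<close>)
  also have "\<dots> = (\<Sum>c\<in>PiE {..<t} B. 2 ^ n)"
  proof (rule sum.cong[OF refl])
    fix c assume "c \<in> PiE {..<t} B"
    then show "(\<Sum>x\<in>{x\<in>?X. ?g x = c}. 4 ^ t) = (2 :: nat) ^ n"
      using sol[of c] by (simp only: sum_constant of_nat_id)
  qed
  also have "\<dots> = 2 ^ n * (\<Prod>j<t. card (B j))"
    by (simp add: card_PiE)
  finally show ?thesis .
qed

lemma block_add:
  assumes P: "P \<in> row_indices t \<rightarrow>\<^sub>E cube n" and x: "x \<in> cube n" "y \<in> cube n" and j: "j < t"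
  shows "block P (x + y) j = (0, 0) \<longleftrightarrow> block P x j = block P y j"
proof -
  have "P (j, b) \<in> cube n" for b
    using P j by auto
  then have "scalar_prod (P (j, b)) (x + y) = scalar_prod (P (j, b)) x + scalar_prod (P (j, b)) y" for b
    using x by (intro scalar_prod_add_right)
  moreover have "a + b = 0 \<longleftrightarrow> a = b" for a b :: bit
    by (cases a; cases b) simp_all
  ultimately show ?thesis
    by (simp only: block_def prod.inject)
qed

definition block_fun :: "nat \<Rightarrow> nat \<Rightarrow> (nat \<times> bool \<Rightarrow> bit vec) \<Rightarrow> boolfun" where
  "block_fun n t P = (\<lambda>x\<in>cube n. if \<forall>j<t. block P x j \<noteq> (0, 0) then 1 else 0)"

lemma block_fun_boolfuns: "block_fun n t P \<in> boolfuns n"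
  by (simp add: block_fun_def boolfuns_def)

lemma block_fun_eq_1: "x \<in> cube n \<Longrightarrow> block_fun n t P x = 1 \<longleftrightarrow> (\<forall>j<t. block P x j \<noteq> (0, 0))"
  by (simp add: block_fun_def)

text \<open>Each triangle inside the support \<open>A\<close> has a vertex where \<open>g\<close>
  differs, that is, in \<open>D\<close>. With \<open>K\<close> triangles through each point, the
  three choices of that vertex account for at most \<open>3 * card (A \<inter> D) * K\<close> of the
  \<open>card A * K\<close> triangles.\<close>

lemma block_fun_far:
  assumes P: "P \<in> row_indices t \<rightarrow>\<^sub>E cube n" and ind: "independent_rows n (row_indices t) P"
    and g: "g \<in> triangle_free n"
  shows "(3 / 4) ^ t / 3 \<le> fun_dist n (block_fun n t P) g"
proof -
  let ?f = "block_fun n t P"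
  define A where "A = {x\<in>cube n. \<forall>j<t. block P x j \<in> UNIV - {(0, 0)}}"
  define D where "D = {x\<in>cube n. ?f x \<noteq> g x}"
  define N where "N a = {x\<in>A. x + a \<in> A}" for a
  define T where "T = Sigma A N"
  have fin: "finite A" "finite D" "finite (N a)" for a
    by (auto simp: A_def D_def N_def)
  have Ac: "A \<subseteq> cube n"
    by (auto simp: A_def)
  have cardA: "card A * 4 ^ t = 2 ^ n * 3 ^ t"
    unfolding A_def card_blocks[OF P ind] by (simp add: card_Diff_singleton card_UNIV_bit)
  \<comment> \<open>Block \<open>j\<close> of \<open>x\<close> must avoid 0 and, since
    \<open>x + a\<close> has to be nonzero there, also block \<open>j\<close> of \<open>a\<close>;
    these differ, so two of four values remain.\<close>
  have cardN: "card (N a) * 4 ^ t = 2 ^ n * 2 ^ t" if a: "a \<in> A" for a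
  proof -
    have ac: "a \<in> cube n" "\<And>j. j < t \<Longrightarrow> block P a j \<noteq> (0, 0)"
      using a by (auto simp: A_def)
    have "x \<in> N a \<longleftrightarrow> x \<in> {x\<in>cube n. \<forall>j<t. block P x j \<in> UNIV - {(0, 0), block P a j}}" for x
    proof (cases "x \<in> cube n")
      case True
      then have "x + a \<in> cube n"
        using ac by simp
      then show ?thesis
        using True block_add[OF P True ac(1)] by (auto simp: N_def A_def)
    qed (auto simp: N_def A_def)
    then have "N a = {x\<in>cube n. \<forall>j<t. block P x j \<in> UNIV - {(0, 0), block P a j}}"
      by blast
    then have "card (N a) * 4 ^ t = 2 ^ n * (\<Prod>j<t. card (UNIV - {(0, 0), block P a j}))"
      by (simp only: card_blocks[OF P ind])
    also have "(\<Prod>j<t. card (UNIV - {(0, 0), block P a j})) = (\<Prod>j<t. 2)"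
    proof (rule prod.cong[OF refl])
      fix j assume "j \<in> {..<t}"
      then have "card {(0, 0), block P a j} = 2"
        using ac(2)[of j] by auto
      then show "card (UNIV - {(0, 0), block P a j}) = 2"
        by (simp add: card_Diff_subset card_UNIV_bit)
    qed
    finally show ?thesis
      by simp
  qed
  obtain K where K: "K * 4 ^ t = 2 ^ n * (2::nat) ^ t"
    "\<And>a. a \<in> A \<Longrightarrow> card (N a) = K"
  proof (cases "A = {}")
    case True
    then have "(2::nat) ^ n * 3 ^ t = 0"
      using cardA by simp
    then show ?thesis
      by simp
  next
    case False
    then obtain a0 where "a0 \<in> A"
      by blast
    then show ?thesis
      using that[of "card (N a0)"] cardN by (metis mult_cancel2 power_not_zero zero_neq_numeral)
  qed
  have "K > 0"
    using K(1) by (metis gr0I mult_is_0 power_not_zero zero_neq_numeral)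
  define T1 where "T1 = Sigma (A \<inter> D) N"
  have cT: "card T = card A * K"
    unfolding T_def using fin by (simp add: card_SigmaI K(2))
  have cT1: "card T1 = card (A \<inter> D) * K"
    unfolding T1_def using fin by (simp add: card_SigmaI K(2))
  have fT: "finite T" "finite T1"
    unfolding T_def T1_def using fin by auto
  have TD: "(a, x) \<in> T \<longleftrightarrow> a \<in> A \<and> x \<in> A \<and> x + a \<in> A" for a x
    by (auto simp: T_def N_def)
  have T1D: "(a, x) \<in> T1 \<longleftrightarrow> a \<in> A \<and> a \<in> D \<and> x \<in> A \<and> x + a \<in> A" for a x
    by (auto simp: T1_def N_def)
  \<comment> \<open>The third vertex of \<open>(a, x)\<close> is \<open>x + a\<close>. Permuting the
    vertices maps triangles whose second or third vertex is in \<open>D\<close> injectively to those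
    whose first vertex is.\<close>
  let ?T2 = "{p\<in>T. snd p \<in> D}" and ?T3 = "{p\<in>T. snd p + fst p \<in> D}"
  have c2: "card ?T2 \<le> card T1"
  proof (rule card_inj_on_le[OF _ _ fT(2)])
    show "inj_on prod.swap ?T2"
      by simp
    show "prod.swap ` ?T2 \<subseteq> T1"
    proof
      fix q assume "q \<in> prod.swap ` ?T2"
      then obtain a x where q: "q = (x, a)" "(a, x) \<in> T" "x \<in> D"
        by auto
      then have ax: "a \<in> A" "x \<in> A" "x + a \<in> A"
        by (simp_all add: TD)
      then have "a + x = x + a"
        using Ac by (intro comm_add_vec) blast+
      then have "a + x \<in> A"
        using ax(3) by simp
      then show "q \<in> T1"
        using q by (simp add: TD T1D)
    qed
  qed
  have c3: "card ?T3 \<le> card T1"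
  proof (rule card_inj_on_le[OF _ _ fT(2)])
    show "inj_on (\<lambda>p. (snd p + fst p, snd p)) ?T3"
    proof (rule inj_onI)
      fix p q assume p: "p \<in> ?T3" and q: "q \<in> ?T3"
        and e: "(snd p + fst p, snd p) = (snd q + fst q, snd q)"
      have "snd p \<in> cube n" "fst p \<in> cube n" "fst q \<in> cube n"
        using p q Ac by (auto simp: T_def N_def)
      then have "fst p = fst q"
        using e cube_add_left_cancel by (metis prod.inject)
      then show "p = q"
        using e by (simp add: prod_eq_iff)
    qed
    show "(\<lambda>p. (snd p + fst p, snd p)) ` ?T3 \<subseteq> T1"
    proof
      fix q assume "q \<in> (\<lambda>p. (snd p + fst p, snd p)) ` ?T3"
      then obtain a x where q: "q = (x + a, x)" "(a, x) \<in> T" "x + a \<in> D"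
        by auto
      then have "a \<in> cube n" "x \<in> cube n"
        using Ac by (auto simp: TD)
      then have "x + (x + a) = a"
        using cube_add_left_cancel by blast
      then show "q \<in> T1"
        using q by (simp add: TD T1D)
    qed
  qed
  have "T \<subseteq> T1 \<union> ?T2 \<union> ?T3"
  proof (rule subsetI)
    fix p assume p: "p \<in> T"
    obtain a x where ax: "p = (a, x)"
      by (cases p)
    have t: "a \<in> A" "x \<in> A" "x + a \<in> A"
      using p by (auto simp: ax TD)
    have f1: "?f u = 1" if "u \<in> A" for u
      using that by (auto simp: A_def block_fun_eq_1)
    show "p \<in> T1 \<union> ?T2 \<union> ?T3"
    proof (rule ccontr)
      assume "\<not> ?thesis"
      then have nD: "a \<notin> D" "x \<notin> D" "x + a \<notin> D"
        using p t by (auto simp: ax T1D)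
      have "g u = 1" if "u \<in> A" "u \<notin> D" for u
        using that Ac f1[OF that(1)] by (auto simp: D_def)
      then have "g a = 1" "g x = 1" "g (x + a) = 1"
        using t nD by blast+
      then show False
        using triangle_freeD[OF g, of x a] t Ac by blast
    qed
  qed
  then have "card T \<le> card (T1 \<union> ?T2 \<union> ?T3)"
    by (intro card_mono) (use fT in auto)
  also have "\<dots> \<le> card T1 + card ?T2 + card ?T3"
    using card_Un_le[of "T1 \<union> ?T2" ?T3] card_Un_le[of T1 ?T2] by linarith
  also have "\<dots> \<le> 3 * card T1"
    using c2 c3 by linarith
  finally have "card A * K \<le> (3 * card (A \<inter> D)) * K"
    unfolding cT cT1 by (simp only: mult.assoc)
  then have "card A \<le> 3 * card (A \<inter> D)"
    using \<open>K > 0\<close> by simp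
  also have "\<dots> \<le> 3 * card D"
    using fin by (simp add: card_mono)
  finally have AD: "real (card A) \<le> 3 * real (card D)"
    by linarith
  have "real (card A) * 4 ^ t = 2 ^ n * 3 ^ t"
    using arg_cong[OF cardA, of real] by simp
  then have "real (card A) = 2 ^ n * (3 / 4) ^ t"
    by (simp add: power_divide field_simps)
  then have "(3 / 4) ^ t / 3 * 2 ^ n \<le> real (card D)"
    using AD by (simp add: mult.commute)
  then have "(3 / 4) ^ t / 3 \<le> real (card D) / 2 ^ n"
    by (simp add: pos_le_divide_eq)
  then show ?thesis
    by (simp add: fun_dist_eq_card D_def card_cube)
qed

section \<open>The lower bound\<close>

lemma independent_rows_pair:
  assumes x: "x \<in> cube n" "x \<noteq> 0\<^sub>v n" and y: "y \<in> cube n" "y \<noteq> 0\<^sub>v n" and "x \<noteq> y"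
  shows "independent_rows n UNIV (\<lambda>b. if b then y else x)"
  unfolding independent_rows_def
proof (intro allI impI)
  fix S :: "bool set" assume "S \<noteq> {}"
  then have "S = {False} \<or> S = {True} \<or> S = UNIV"
    unfolding set_eq_iff all_bool_eq by auto
  then consider "S = {False}" | "S = {True}" | "S = UNIV"
    by blast
  then show "\<exists>z\<in>cube n. (\<Sum>b\<in>S. scalar_prod (if b then y else x) z) \<noteq> 0"
  proof cases
    case 1
    obtain z where "z \<in> cube n" "scalar_prod x z \<noteq> 0"
      by (rule ex_scalar_prod_ne_0[OF x])
    then show ?thesis
      unfolding 1 by (intro bexI[of _ z]) simp_all
  next
    case 2
    obtain z where "z \<in> cube n" "scalar_prod y z \<noteq> 0"
      by (rule ex_scalar_prod_ne_0[OF y])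
    then show ?thesis
      unfolding 2 by (intro bexI[of _ z]) simp_all
  next
    case 3
    have "x + y \<in> cube n" "x + y \<noteq> 0\<^sub>v n"
      using x(1) y(1) \<open>x \<noteq> y\<close> by (simp_all add: cube_add_eq_0_iff[OF x(1) y(1)])
    then obtain z where z: "z \<in> cube n" "scalar_prod (x + y) z \<noteq> 0"
      by (rule ex_scalar_prod_ne_0)
    have "scalar_prod (x + y) z = scalar_prod x z + scalar_prod y z"
      by (rule add_scalar_prod_distrib[OF x(1) y(1) z(1)])
    moreover have "(\<Sum>b\<in>UNIV. scalar_prod (if b then y else x) z) = scalar_prod x z + scalar_prod y z"
      by (simp only: UNIV_bool) simp
    ultimately show ?thesis
      unfolding 3 using z by (intro bexI[of _ z]) simp_all
  qed
qed

text \<open>Distinct nonzero points are linearly independent over F_2, so their images under a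
  random pair of rows are uniform on the 16 pairs of elements of F_2^2.\<close>

lemma card_triangle_pairs:
  assumes x: "x \<in> cube n" "x \<noteq> 0\<^sub>v n" and y: "y \<in> cube n" "y \<noteq> 0\<^sub>v n" and ne: "x \<noteq> y"
  shows "card {(r, s)\<in>cube n \<times> cube n. (scalar_prod r x, scalar_prod s x) \<noteq> (0, 0) \<and>
    (scalar_prod r y, scalar_prod s y) \<noteq> (0, 0) \<and>
    (scalar_prod r x, scalar_prod s x) \<noteq> (scalar_prod r y, scalar_prod s y)} * 8 \<le> 3 * (2 ^ n * 2 ^ n)"
    (is "card ?G * 8 \<le> _")
proof -
  \<comment> \<open>The 6 pairs of distinct nonzero elements, transposed: grouped by the rows
    \<open>r\<close> and \<open>s\<close>, which are chosen independently, instead of by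
    \<open>x\<close> and \<open>y\<close>.\<close>
  define W :: "((bit \<times> bit) \<times> (bit \<times> bit)) set" where "W = {((0, 1), (1, 0)), ((0, 1), (1, 1)),
    ((1, 0), (0, 1)), ((1, 1), (0, 1)), ((1, 0), (1, 1)), ((1, 1), (1, 0))}"
  define F where "F c = {r\<in>cube n. scalar_prod r x = fst c \<and> scalar_prod r y = snd c}" for c :: "bit \<times> bit"
  have F: "card (F c) * 4 = 2 ^ n" for c
  proof -
    have "F c = {r\<in>cube n. \<forall>b\<in>UNIV. scalar_prod (if b then y else x) r = (if b then snd c else fst c)}"
      using comm_scalar_prod[OF x(1)] comm_scalar_prod[OF y(1)] by (auto simp: F_def all_bool_eq)
    moreover have "card {r\<in>cube n. \<forall>b\<in>UNIV. scalar_prod (if b then y else x) r = (if b then snd c else fst c)}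
      * 2 ^ card (UNIV :: bool set) = card (cube n)"
      by (rule card_solutions[OF _ _ independent_rows_pair[OF x y ne]]) (use x y in simp_all)
    ultimately show ?thesis
      by (simp add: card_cube)
  qed
  have fF: "finite (F c)" for c
    by (simp add: F_def)
  have *: "(a, c) \<noteq> (0, 0) \<Longrightarrow> (b, d) \<noteq> (0, 0) \<Longrightarrow> (a, c) \<noteq> (b, d) \<Longrightarrow> ((a, b), (c, d)) \<in> W" for a b c d
    unfolding W_def by (cases a; cases b; cases c; cases d) simp_all
  have "?G \<subseteq> (\<Union>w\<in>W. F (fst w) \<times> F (snd w))"
  proof
    fix p assume p: "p \<in> ?G"
    obtain r s where rs: "p = (r, s)"
      by (cases p)
    let ?w = "((scalar_prod r x, scalar_prod r y), (scalar_prod s x, scalar_prod s y))"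
    have "?w \<in> W"
      using p unfolding rs by (intro *) auto
    moreover have "p \<in> F (fst ?w) \<times> F (snd ?w)"
      using p unfolding rs by (simp add: F_def)
    ultimately show "p \<in> (\<Union>w\<in>W. F (fst w) \<times> F (snd w))"
      by blast
  qed
  then have "card ?G \<le> card (\<Union>w\<in>W. F (fst w) \<times> F (snd w))"
    by (rule card_mono[rotated]) (simp add: W_def fF)
  also have "\<dots> \<le> (\<Sum>w\<in>W. card (F (fst w) \<times> F (snd w)))"
    by (rule card_UN_le) (simp add: W_def)
  finally have "card ?G * 16 \<le> (\<Sum>w\<in>W. card (F (fst w) \<times> F (snd w))) * 16"
    by simp
  also have "\<dots> = (\<Sum>w\<in>W. (card (F (fst w)) * 4) * (card (F (snd w)) * 4))"
    by (simp only: sum_distrib_right card_cartesian_product) (intro sum.cong refl, simp)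
  also have "\<dots> = card W * (2 ^ n * 2 ^ n)"
    by (simp only: F sum_constant of_nat_id)
  also have "\<dots> \<le> 6 * (2 ^ n * 2 ^ n)"
    by (rule mult_right_mono) (simp_all add: W_def card_insert_if)
  finally show ?thesis
    by simp
qed

text \<open>Different blocks use disjoint sets of rows, so the bound for a single block is raised to
  the power \<open>t\<close>.\<close>

lemma card_block_triangle:
  assumes x: "x \<in> cube n" "x \<noteq> 0\<^sub>v n" and y: "y \<in> cube n" "y \<noteq> 0\<^sub>v n" and ne: "x \<noteq> y"
  shows "real (card {P\<in>row_indices t \<rightarrow>\<^sub>E cube n. block_fun n t P x = 1 \<and> block_fun n t P y = 1 \<and>
      block_fun n t P (x + y) = 1}) \<le> (3 / 8) ^ t * card (row_indices t \<rightarrow>\<^sub>E cube n)"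
    (is "real (card ?E) \<le> _")
proof -
  define G where "G = {(r, s)\<in>cube n \<times> cube n. (scalar_prod r x, scalar_prod s x) \<noteq> (0, 0) \<and>
    (scalar_prod r y, scalar_prod s y) \<noteq> (0, 0) \<and>
    (scalar_prod r x, scalar_prod s x) \<noteq> (scalar_prod r y, scalar_prod s y)}"
  let ?h = "\<lambda>P. \<lambda>j\<in>{..<t}. (P (j, False), P (j, True))"
  have "card (row_indices t \<rightarrow>\<^sub>E cube n) = (2 ^ n) ^ (2 * t)"
    by (simp add: card_PiE card_cube card_cartesian_product mult.commute[of t 2])
  then have size: "real (card (row_indices t \<rightarrow>\<^sub>E cube n)) = (2 ^ n) ^ t * (2 ^ n) ^ t"
    by (simp only: of_nat_mult of_nat_power of_nat_numeral mult_2 power_add)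
  have fG: "finite G"
    unfolding G_def by (rule finite_subset[of _ "cube n \<times> cube n"]) auto
  have "card ?E \<le> card ({..<t} \<rightarrow>\<^sub>E G)"
  proof (rule card_inj_on_le)
    show "inj_on ?h ?E"
    proof (rule inj_onI)
      fix P Q assume PQ: "P \<in> ?E" "Q \<in> ?E" and e: "?h P = ?h Q"
      have "P i = Q i" if it: "i \<in> row_indices t" for i
      proof -
        obtain j b where i: "i = (j, b)" "j < t"
          using it by (cases i) auto
        have "?h P j = ?h Q j"
          by (rule fun_cong[OF e])
        then show ?thesis
          using i by (cases b) simp_all
      qed
      then show "P = Q"
        using PQ by (intro PiE_ext[of P "row_indices t" "\<lambda>_. cube n" Q]) simp_all
    qed
    show "?h ` ?E \<subseteq> {..<t} \<rightarrow>\<^sub>E G"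
    proof
      fix h assume "h \<in> ?h ` ?E"
      then obtain P where h: "h = ?h P" and P: "P \<in> row_indices t \<rightarrow>\<^sub>E cube n"
        and b: "block_fun n t P x = 1" "block_fun n t P y = 1" "block_fun n t P (x + y) = 1"
        by blast
      have xy: "x + y \<in> cube n"
        using x y by simp
      have "(P (j, False), P (j, True)) \<in> G" if j: "j < t" for j
      proof -
        have "block P x j \<noteq> (0, 0)" "block P y j \<noteq> (0, 0)" "block P (x + y) j \<noteq> (0, 0)"
          using b j unfolding block_fun_eq_1[OF x(1)] block_fun_eq_1[OF y(1)] block_fun_eq_1[OF xy] by blast+
        then have "block P x j \<noteq> (0, 0)" "block P y j \<noteq> (0, 0)" "block P x j \<noteq> block P y j"
          using block_add[OF P x(1) y(1) j] by blast+
        moreover have "P (j, False) \<in> cube n" "P (j, True) \<in> cube n"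
          using P j by auto
        ultimately show ?thesis
          unfolding block_def G_def by blast
      qed
      then show "h \<in> {..<t} \<rightarrow>\<^sub>E G"
        unfolding h by (intro restrict_PiE_iff[THEN iffD2]) blast
    qed
    show "finite ({..<t} \<rightarrow>\<^sub>E G)"
      using fG by (intro finite_PiE) simp_all
  qed
  also have "\<dots> = card G ^ t"
    by (subst card_PiE) simp_all
  finally have "real (card ?E) \<le> real (card G) ^ t"
    by (simp only: of_nat_power[symmetric] of_nat_le_iff)
  also have "\<dots> \<le> (3 / 8 * (2 ^ n * 2 ^ n)) ^ t"
  proof (rule power_mono)
    have "real (card G * 8) \<le> real (3 * (2 ^ n * 2 ^ n))"
      using card_triangle_pairs[OF x y ne, folded G_def] by (simp only: of_nat_le_iff)
    then show "real (card G) \<le> 3 / 8 * (2 ^ n * 2 ^ n)"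
      by simp
  qed simp
  also have "\<dots> = (3 / 8) ^ t * card (row_indices t \<rightarrow>\<^sub>E cube n)"
    unfolding power_mult_distrib using size by (simp only:)
  finally show ?thesis .
qed

section \<open>Query answers consistent with a nonlinear triangle-free function\<close>

lemma accepts_cong:
  "(\<And>x. x \<in> set (queries t f) \<Longrightarrow> f x = g x) \<Longrightarrow> accepts t f = accepts t g"
  by (induction t) auto

text \<open>A linear function with value 1 at \<open>a\<close> takes the value 1 at one of
  \<open>y\<close> and \<open>a + y\<close>, for every \<open>y\<close>. Its support therefore fills
  at least half of the cube and cannot be \<open>S\<close>.\<close>

lemma NLTF_support:
  assumes S: "S \<subseteq> cube n" "S \<noteq> {}" "2 * card S < 2 ^ n"
    and free: "\<And>x y. x \<in> S \<Longrightarrow> y \<in> S \<Longrightarrow> x + y \<notin> S"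
  shows "(\<lambda>x\<in>cube n. if x \<in> S then 1 else 0) \<in> NLTF n" (is "?g \<in> _")
proof -
  have gb: "?g \<in> boolfuns n"
    by (simp add: boolfuns_def)
  have g1: "?g x = 1 \<longleftrightarrow> x \<in> S" if "x \<in> cube n" for x
    using that by simp
  have "?g \<in> triangle_free n"
  proof (rule triangle_freeI[OF gb])
    fix x y assume xy: "x \<in> cube n" "y \<in> cube n" "?g x = 1" "?g y = 1" "?g (x + y) = 1"
    have "x + y \<in> cube n"
      using xy by simp
    then show False
      using xy free g1 by blast
  qed
  moreover have "?g \<notin> LIN n"
  proof
    assume lin: "?g \<in> LIN n"
    obtain a where a: "a \<in> S"
      using S(2) by blast
    then have ac: "a \<in> cube n"
      using S(1) by blast
    have fS: "finite S"
      using S(1) finite_cube by (rule finite_subset)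
    have "cube n \<subseteq> S \<union> (\<lambda>x. a + x) ` S"
    proof
      fix y assume y: "y \<in> cube n"
      have ay: "a + y \<in> cube n"
        using ac y by simp
      show "y \<in> S \<union> (\<lambda>x. a + x) ` S"
      proof (rule ccontr)
        assume "\<not> ?thesis"
        then have "y \<notin> S" "a + y \<notin> S"
          using cube_add_left_cancel[OF ac y] by (auto simp: image_iff)
        moreover have "?g a + ?g y = ?g (a + y)"
          using lin ac y unfolding LIN_def by blast
        ultimately show False
          using a ac y ay by simp
      qed
    qed
    then have "card (cube n) \<le> card (S \<union> (\<lambda>x. a + x) ` S)"
      using fS by (intro card_mono) auto
    also have "\<dots> \<le> card S + card ((\<lambda>x. a + x) ` S)"
      by (rule card_Un_le)
    also have "\<dots> \<le> card S + card S"
      using fS by (simp add: card_image_le)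
    finally show False
      using S(3) by (simp add: card_cube)
  qed
  ultimately show ?thesis
    by (simp add: NLTF_def)
qed

text \<open>Otherwise the answers seen are consistent with a member of \<open>NLTF\<close> of small support.\<close>

lemma rejection_sees_triangle:
  assumes xs: "queries tr f = xs" "set xs \<subseteq> cube n" and small: "2 * length xs + 2 < 2 ^ n"
    and acc: "\<And>g. g \<in> NLTF n \<Longrightarrow> accepts tr g"
    and f0: "f (0\<^sub>v n) = 0" and rej: "\<not> accepts tr f"
  obtains x y where "x \<in> set xs" "y \<in> set xs" "x \<noteq> 0\<^sub>v n" "y \<noteq> 0\<^sub>v n" "x \<noteq> y"
    "f x = 1" "f y = 1" "f (x + y) = 1"
proof (rule ccontr)
  assume "\<not> thesis"
  then have no: "\<not> (x \<in> set xs \<and> y \<in> set xs \<and> x \<noteq> 0\<^sub>v n \<and> y \<noteq> 0\<^sub>v n \<and> x \<noteq> y \<and>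
    f x = 1 \<and> f y = 1 \<and> f (x + y) = 1)" for x y
    using that by blast
  have cl: "card (set xs) \<le> length xs"
    by (rule card_length)
  have "card (insert (0\<^sub>v n) (set xs)) \<le> length xs + 1"
    using cl by (simp add: card_insert_if)
  then have "card (insert (0\<^sub>v n) (set xs)) < 2 ^ n"
    using small by linarith
  then obtain z where z: "z \<in> cube n" "z \<notin> insert (0\<^sub>v n) (set xs)"
    by (rule ex_cube_outside[rotated]) simp_all
  define Y where "Y = {x\<in>set xs. f x = 1}"
  \<comment> \<open>If no answer was 1, the zero function fits the answers but is linear. The
    unqueried point \<open>z\<close> then forms the support; as \<open>z\<close> is nonzero,
    \<open>z + z\<close> lies outside it.\<close>
  define S where "S = (if Y = {} then {z} else Y)"
  have "card Y \<le> length xs"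
    using cl card_mono[of "set xs" Y] by (auto simp: Y_def)
  then have cS: "2 * card S < 2 ^ n"
    using small by (auto simp: S_def)
  have S: "S \<subseteq> cube n" "S \<noteq> {}"
    using z(1) xs(2) by (auto simp: S_def Y_def)
  have free: "x + y \<notin> S" if xy: "x \<in> S" "y \<in> S" for x y
  proof (cases "Y = {}")
    case True
    then have "x = z" "y = z"
      using xy by (simp_all add: S_def)
    then have "x + y = 0\<^sub>v n"
      using cube_add_self[OF z(1)] by simp
    then show ?thesis
      using True z(2) by (auto simp: S_def)
  next
    case False
    then have Y: "x \<in> Y" "y \<in> Y" "S = Y"
      using xy by (simp_all add: S_def)
    have "f x = 1" "f y = 1" "x \<in> set xs" "y \<in> set xs"
      using Y by (simp_all add: Y_def)
    moreover have "x \<noteq> 0\<^sub>v n" "y \<noteq> 0\<^sub>v n"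
      using calculation f0 by auto
    \<comment> \<open>Degenerate triangles have the vertex 0, where \<open>f\<close>
      vanishes.\<close>
    moreover have "f (x + y) \<noteq> 1" if "x = y"
      using that f0 cube_add_self[of x n] S(1) xy by auto
    ultimately have "f (x + y) \<noteq> 1"
      using no[of x y] by blast
    then show ?thesis
      unfolding Y(3) by (simp add: Y_def)
  qed
  let ?g = "\<lambda>x\<in>cube n. if x \<in> S then 1 else 0 :: bit"
  have "?g \<in> NLTF n"
    by (rule NLTF_support[OF S cS free])
  moreover have "accepts tr f = accepts tr ?g"
  proof (rule accepts_cong)
    fix x assume "x \<in> set (queries tr f)"
    then have x: "x \<in> set xs" "x \<in> cube n"
      using xs by auto
    then have "x \<in> S \<longleftrightarrow> f x = 1"
      using z(2) by (auto simp: S_def Y_def)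
    then show "f x = ?g x"
      using x(2) by (cases "f x") simp_all
  qed
  ultimately show False
    using acc rej by blast
qed

section \<open>Averaging over the tester and over the linear map\<close>

lemma accept_prob_eq_expectation:
  "accept_prob T f = measure_pmf.expectation T (\<lambda>tr. of_bool (accepts tr f))"
proof -
  have "(\<lambda>tr. of_bool (accepts tr f)) = (indicator {tr. accepts tr f} :: _ \<Rightarrow> real)"
    by (auto simp: fun_eq_iff)
  then show ?thesis
    by (simp add: accept_prob_def)
qed

text \<open>Yao's principle: acceptance is averaged over both the tester and the uniformly random
  rows \<open>P\<close>. Each deterministic tree of the tester rejects at most the fraction
  \<open>\<beta>\<close> of the hard functions, whereas correctness keeps the average acceptance at
  most 2/3.\<close>

lemma nonadaptive_query_bound:
  assumes tester: "one_sided_tester NLTF n \<epsilon> T" and na: "nonadaptive n T" and mq: "max_queries n T q"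
    and t: "t > 0" and \<epsilon>: "\<epsilon> \<le> (3 / 4) ^ t / 3" and n: "2 * t + 1 \<le> n" "2 * q + 2 < 2 ^ n"
  shows "1 / 3 \<le> (real q)\<^sup>2 * (3 / 8) ^ t"
proof -
  define \<Omega> where "\<Omega> = row_indices t \<rightarrow>\<^sub>E cube n"
  let ?f = "block_fun n t"
  define \<beta> where "\<beta> = (real q)\<^sup>2 * (3 / 8) ^ t"
  have fin: "finite \<Omega>"
    unfolding \<Omega>_def by (intro finite_PiE) simp_all
  have "(\<lambda>i\<in>row_indices t. 0\<^sub>v n) \<in> \<Omega>"
    by (simp add: \<Omega>_def)
  then have pos: "card \<Omega> > 0"
    using fin by (auto simp: card_gt_0_iff)
  have bf: "?f P \<in> boolfuns n" for P
    by (rule block_fun_boolfuns)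
  have f0: "?f P (0\<^sub>v n) = 0" if "P \<in> \<Omega>" for P
  proof -
    have "P (0, b) \<in> cube n" for b
      using that t by (auto simp: \<Omega>_def)
    then have "block P (0\<^sub>v n) 0 = (0, 0)"
      by (simp add: block_def)
    then have "\<not> (\<forall>j<t. block P (0\<^sub>v n) j \<noteq> (0, 0))"
      using t by blast
    then show ?thesis
      by (simp only: block_fun_def) simp
  qed
  have rej: "real (card {P\<in>\<Omega>. \<not> accepts tr (?f P)}) \<le> \<beta> * card \<Omega>" if tr: "tr \<in> set_pmf T" for tr
  proof -
    \<comment> \<open>By non-adaptivity the same query points serve all \<open>P\<close>, so the set
      \<open>Q\<close> of pairs for the union bound does not depend on \<open>P\<close>.\<close>
    obtain xs where xs: "\<And>f. f \<in> boolfuns n \<Longrightarrow> queries tr f = xs"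
      using na tr unfolding nonadaptive_def by blast
    have xsc: "set xs \<subseteq> cube n"
      using tester tr xs[OF bf] bf unfolding one_sided_tester_def by metis
    have len: "length xs \<le> q"
      using mq tr xs[OF bf] bf unfolding max_queries_def by metis
    \<comment> \<open>One-sided error, that is, acceptance with probability 1, constrains every
      single tree in the support of \<open>T\<close>.\<close>
    have acc: "accepts tr g" if "g \<in> NLTF n" for g
    proof -
      have "measure_pmf.prob T {t. accepts t g} = 1"
        using tester that unfolding one_sided_tester_def accept_prob_def by blast
      then have "AE t in measure_pmf T. t \<in> {t. accepts t g}"
        by (subst measure_pmf.prob_eq_1[symmetric]) simp_all
      then show ?thesis
        using tr by (simp add: AE_measure_pmf_iff)
    qed
    define Q where "Q = {(x, y)\<in>set xs \<times> set xs. x \<noteq> 0\<^sub>v n \<and> y \<noteq> 0\<^sub>v n \<and> x \<noteq> y}"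
    define E where "E = (\<lambda>(x, y). {P\<in>\<Omega>. ?f P x = 1 \<and> ?f P y = 1 \<and> ?f P (x + y) = 1})"
    have finE: "finite (E p)" for p
      using fin by (auto simp: E_def split: prod.split)
    have QX: "Q \<subseteq> set xs \<times> set xs"
      by (auto simp: Q_def)
    have finQ: "finite Q"
      by (rule finite_subset[OF QX]) simp
    have "{P\<in>\<Omega>. \<not> accepts tr (?f P)} \<subseteq> (\<Union>p\<in>Q. E p)"
    proof
      fix P assume "P \<in> {P\<in>\<Omega>. \<not> accepts tr (?f P)}"
      then have P: "P \<in> \<Omega>" "\<not> accepts tr (?f P)"
        by simp_all
      have "2 * length xs + 2 < 2 ^ n"
        using len n(2) by linarith
      then obtain x y where "x \<in> set xs" "y \<in> set xs" "x \<noteq> 0\<^sub>v n" "y \<noteq> 0\<^sub>v n" "x \<noteq> y"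
        "?f P x = 1" "?f P y = 1" "?f P (x + y) = 1"
        by (rule rejection_sees_triangle[OF xs[OF bf] xsc _ acc f0[OF P(1)] P(2)])
      then have "(x, y) \<in> Q" "P \<in> E (x, y)"
        using P(1) by (simp_all add: Q_def E_def)
      then show "P \<in> (\<Union>p\<in>Q. E p)"
        by blast
    qed
    then have "card {P\<in>\<Omega>. \<not> accepts tr (?f P)} \<le> card (\<Union>p\<in>Q. E p)"
      by (rule card_mono[rotated]) (simp add: finQ finE)
    also have "\<dots> \<le> (\<Sum>p\<in>Q. card (E p))"
      by (rule card_UN_le[OF finQ])
    finally have "real (card {P\<in>\<Omega>. \<not> accepts tr (?f P)}) \<le> (\<Sum>p\<in>Q. real (card (E p)))"
      by (simp only: of_nat_sum[symmetric] of_nat_le_iff)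
    also have "\<dots> \<le> (\<Sum>p\<in>Q. (3 / 8) ^ t * card \<Omega>)"
    proof (rule sum_mono)
      fix p assume p: "p \<in> Q"
      obtain x y where xy: "p = (x, y)"
        by (cases p)
      have "x \<in> cube n" "y \<in> cube n" "x \<noteq> 0\<^sub>v n" "y \<noteq> 0\<^sub>v n" "x \<noteq> y"
        using p xsc unfolding xy Q_def by auto
      then show "real (card (E p)) \<le> (3 / 8) ^ t * card \<Omega>"
        unfolding xy E_def \<Omega>_def prod.case by (intro card_block_triangle)
    qed
    also have "\<dots> = real (card Q) * ((3 / 8) ^ t * card \<Omega>)"
      by simp
    also have "\<dots> \<le> (real q)\<^sup>2 * ((3 / 8) ^ t * card \<Omega>)"
    proof (rule mult_right_mono)
      have "card Q \<le> card (set xs \<times> set xs)"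
        by (rule card_mono[OF _ QX]) simp
      also have "\<dots> = card (set xs) * card (set xs)"
        by (rule card_cartesian_product)
      also have "\<dots> \<le> q * q"
        using card_length[of xs] len by (intro mult_mono) auto
      finally show "real (card Q) \<le> (real q)\<^sup>2"
        by (simp only: power2_eq_square of_nat_mult[symmetric] of_nat_le_iff)
    qed simp
    finally show ?thesis
      by (simp add: \<beta>_def mult.assoc)
  qed
  have lower: "(1 - \<beta>) * card \<Omega> \<le> (\<Sum>P\<in>\<Omega>. accept_prob T (?f P))"
  proof -
    let ?s = "\<lambda>tr. \<Sum>P\<in>\<Omega>. of_bool (accepts tr (?f P)) :: real"
    have int: "integrable (measure_pmf T) (\<lambda>tr. of_bool (accepts tr f) :: real)" for f
      by (rule measure_pmf.integrable_const_bound[where B = 1]) simp_all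
    have "(1 - \<beta>) * card \<Omega> \<le> ?s tr" if tr: "tr \<in> set_pmf T" for tr
    proof -
      have "card \<Omega> = card ({P\<in>\<Omega>. accepts tr (?f P)} \<union> {P\<in>\<Omega>. \<not> accepts tr (?f P)})"
        by (rule arg_cong[of _ _ card]) blast
      also have "\<dots> = card {P\<in>\<Omega>. accepts tr (?f P)} + card {P\<in>\<Omega>. \<not> accepts tr (?f P)}"
        by (rule card_Un_disjoint) (use fin in auto)
      finally have "real (card \<Omega>) = real (card {P\<in>\<Omega>. accepts tr (?f P)}) + real (card {P\<in>\<Omega>. \<not> accepts tr (?f P)})"
        by linarith
      moreover have "?s tr = real (card {P\<in>\<Omega>. accepts tr (?f P)})"
      proof -
        have "?s tr = (\<Sum>P\<in>\<Omega>. if accepts tr (?f P) then 1 else 0)"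
          by (intro sum.cong refl) simp
        also have "\<dots> = (\<Sum>P\<in>{P\<in>\<Omega>. accepts tr (?f P)}. 1)"
          by (rule sum.inter_filter[symmetric, OF fin])
        finally show ?thesis
          by simp
      qed
      ultimately show ?thesis
        using rej[OF tr] by (simp add: left_diff_distrib)
    qed
    then have "(1 - \<beta>) * card \<Omega> \<le> measure_pmf.expectation T ?s"
      by (intro measure_pmf.integral_ge_const) (simp_all add: int AE_measure_pmf_iff)
    also have "\<dots> = (\<Sum>P\<in>\<Omega>. accept_prob T (?f P))"
      unfolding accept_prob_eq_expectation by (rule Bochner_Integration.integral_sum) (rule int)
    finally show ?thesis .
  qed
  define D where "D = {P\<in>\<Omega>. \<not> independent_rows n (row_indices t) P}"
  have D: "2 * real (card D) \<le> card \<Omega>"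
  proof -
    have "card D * 2 ^ n \<le> 2 ^ card (row_indices t) * card \<Omega>"
      unfolding D_def \<Omega>_def by (rule card_dependent_le) simp
    also have "card (row_indices t) = 2 * t"
      by (simp add: card_cartesian_product)
    finally have "card D * 2 ^ n \<le> 2 ^ (2 * t) * card \<Omega>" .
    moreover have "(2::nat) ^ n \<ge> 2 * 2 ^ (2 * t)"
      using power_increasing[OF n(1), of "2::nat"] by simp
    then have "card D * (2 * 2 ^ (2 * t)) \<le> card D * 2 ^ n"
      by (rule mult_left_mono) simp
    ultimately have "2 ^ (2 * t) * (2 * card D) \<le> 2 ^ (2 * t) * card \<Omega>"
      by (simp only: mult_ac)
    then have "2 * card D \<le> card \<Omega>"
      by simp
    then show ?thesis
      by linarith
  qed
  \<comment> \<open>Far functions are accepted with probability at most 1/3, the others trivially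
    with at most 1; as dependent rows make up at most half, the average is at most 1/3 + 1/2 *
    2/3.\<close>
  have upper: "(\<Sum>P\<in>\<Omega>. accept_prob T (?f P)) \<le> 2 / 3 * card \<Omega>"
  proof -
    have far: "accept_prob T (?f P) \<le> 1 / 3" if P: "P \<in> \<Omega>" "independent_rows n (row_indices t) P" for P
    proof -
      have "ereal \<epsilon> \<le> property_dist n (?f P) (NLTF n)"
        unfolding property_dist_def
      proof (rule INF_greatest)
        fix g assume "g \<in> NLTF n"
        then have "(3 / 4) ^ t / 3 \<le> fun_dist n (?f P) g"
          using P by (intro block_fun_far) (simp_all add: \<Omega>_def NLTF_def)
        then show "ereal \<epsilon> \<le> ereal (fun_dist n (?f P) g)"
          using \<epsilon> by simp
      qed
      then show ?thesis
        using tester bf unfolding one_sided_tester_def by blast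
    qed
    have "(\<Sum>P\<in>\<Omega>. accept_prob T (?f P)) \<le> (\<Sum>P\<in>\<Omega>. 1 / 3 + (if \<not> independent_rows n (row_indices t) P then 2 / 3 else 0))"
    proof (rule sum_mono)
      fix P assume "P \<in> \<Omega>"
      moreover have "accept_prob T (?f P) \<le> 1"
        by (simp add: accept_prob_def)
      ultimately show "accept_prob T (?f P) \<le> 1 / 3 + (if \<not> independent_rows n (row_indices t) P then 2 / 3 else 0)"
        using far[of P] by simp
    qed
    also have "\<dots> = card \<Omega> / 3 + (\<Sum>P\<in>\<Omega>. if \<not> independent_rows n (row_indices t) P then 2 / 3 else 0)"
      by (simp add: sum.distrib)
    also have "(\<Sum>P\<in>\<Omega>. if \<not> independent_rows n (row_indices t) P then 2 / 3 else 0) = (\<Sum>P\<in>D. 2 / 3 :: real)"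
      unfolding D_def by (rule sum.inter_filter[symmetric, OF fin])
    also have "\<dots> = 2 / 3 * real (card D)"
      by simp
    finally show ?thesis
      using D by simp
  qed
  have "(1 - \<beta>) * card \<Omega> \<le> 2 / 3 * card \<Omega>"
    using lower upper by (rule order_trans)
  then have "1 - \<beta> \<le> 2 / 3"
    using pos by (simp add: mult_le_cancel_right)
  then show ?thesis
    by (simp add: \<beta>_def)
qed

text \<open>Given \<open>\<epsilon>\<close>, the largest \<open>t\<close> with
  \<open>\<epsilon> \<le> (3 / 4) ^ t / 3\<close> is used: it makes \<open>1 / \<epsilon>\<close> at
  most \<open>4 * (4 / 3) ^ t\<close>, while the query bound gives
  \<open>(8 / 3) ^ t \<le> 3 * (real (q \<epsilon>))\<^sup>2\<close>.\<close>

lemma nonadaptive_lower_bound: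
  assumes fam: "one_sided_tester_family NLTF T q" and na: "\<forall>\<epsilon>>0. \<forall>n. nonadaptive n (T \<epsilon> n)"
  shows "(\<lambda>\<epsilon>. real (q \<epsilon>)) \<in> \<omega>[at_right 0](\<lambda>\<epsilon>. 1 / \<epsilon>)"
  unfolding smallomega_def
proof (intro CollectI allI impI)
  fix c :: real assume c: "c > 0"
  have bound: "1 / 3 \<le> (real (q \<epsilon>))\<^sup>2 * (3 / 8) ^ t" if "\<epsilon> > 0" "t > 0" "\<epsilon> \<le> (3 / 4) ^ t / 3" for \<epsilon> t
  proof (rule nonadaptive_query_bound)
    let ?n = "2 * t + q \<epsilon> + 3" \<comment> \<open>The query bound does not depend on the dimension, which may thus be chosen large.\<close>
    show "one_sided_tester NLTF ?n \<epsilon> (T \<epsilon> ?n)" "max_queries ?n (T \<epsilon> ?n) (q \<epsilon>)" "nonadaptive ?n (T \<epsilon> ?n)"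
      using fam na that(1) unfolding one_sided_tester_family_def by blast+
    have "q \<epsilon> < 2 ^ q \<epsilon>"
      by (rule less_exp)
    then have "2 * q \<epsilon> + 2 < 8 * 2 ^ q \<epsilon>"
      by linarith
    also have "(8::nat) * 2 ^ q \<epsilon> = 2 ^ (q \<epsilon> + 3)"
      by (simp add: power_add)
    also have "\<dots> \<le> 2 ^ ?n"
      by (rule power_increasing) simp_all
    finally show "2 * q \<epsilon> + 2 < 2 ^ ?n" .
  qed (use that in simp_all)
  \<comment> \<open>After squaring, the comparison reads
    \<open>16 * c\<^sup>2 * (16 / 9) ^ t \<le> (8 / 3) ^ t / 3\<close>; this gives 48 = 3 * 16 and
    the ratio 3/2 of 8/3 to 16/9. The successor in \<open>t0\<close> keeps \<open>t\<close>
    positive.\<close>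
  obtain m where m: "48 * c\<^sup>2 < (3 / 2) ^ m"
    using real_arch_pow[of "3 / 2" "48 * c\<^sup>2"] by auto
  define t0 where "t0 = Suc m"
  have t0: "48 * c\<^sup>2 \<le> (3 / 2) ^ t" if "t0 \<le> t" for t
  proof -
    have "(3 / 2 :: real) ^ m \<le> (3 / 2) ^ t"
      using that by (intro power_increasing) (simp_all add: t0_def)
    then show ?thesis
      using m by linarith
  qed
  have "c / \<epsilon> \<le> real (q \<epsilon>)" if \<epsilon>: "\<epsilon> > 0" "\<epsilon> < (3 / 4) ^ t0 / 3" for \<epsilon>
  proof -
    let ?P = "\<lambda>k. (3 / 4) ^ k / 3 < \<epsilon>"
    obtain k where "(3 / 4) ^ k < 3 * \<epsilon>"
      using real_arch_pow_inv[of "3 * \<epsilon>" "3 / 4"] \<epsilon>(1) by auto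
    then have k: "?P k"
      by simp
    have least: "?P (LEAST k. ?P k)"
      using k by (rule LeastI)
    have "\<not> ?P j" if "j \<le> t0" for j
    proof -
      have "(3 / 4 :: real) ^ t0 \<le> (3 / 4) ^ j"
        using that by (intro power_decreasing) simp_all
      then show ?thesis
        using \<epsilon>(2) by linarith
    qed
    then have gt: "t0 < (LEAST k. ?P k)"
      using least by (meson not_le)
    \<comment> \<open>The predecessor of the first failure is the last exponent for which the
      distance bound still covers \<open>\<epsilon>\<close>; \<open>gt\<close> ensures that it
      exists and is at least \<open>t0\<close>.\<close>
    define t where "t = (LEAST k. ?P k) - 1"
    have t: "Suc t = (LEAST k. ?P k)" "t0 \<le> t"
      using gt by (simp_all add: t_def)
    have lt: "(3 / 4) ^ Suc t / 3 < \<epsilon>"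
      using least unfolding t(1) .
    have "\<not> ?P t"
      by (rule not_less_Least) (unfold t(1)[symmetric], rule lessI)
    then have "1 / 3 \<le> (real (q \<epsilon>))\<^sup>2 * (3 / 8) ^ t"
      using \<epsilon>(1) t(2) by (intro bound) (simp_all add: t0_def)
    then have q: "(8 / 3) ^ t \<le> 3 * (real (q \<epsilon>))\<^sup>2"
      by (simp add: power_divide field_simps)
    have "1 / \<epsilon> \<le> 1 / ((3 / 4) ^ Suc t / 3)"
      using lt \<epsilon>(1) by (intro divide_left_mono) simp_all
    also have "\<dots> = 4 * (4 / 3) ^ t"
      by (simp add: power_divide field_simps)
    finally have "c / \<epsilon> \<le> 4 * c * (4 / 3) ^ t"
      using mult_left_mono[of "1 / \<epsilon>" "4 * (4 / 3) ^ t" c] c by (simp add: mult_ac)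
    then have "(c / \<epsilon>)\<^sup>2 \<le> (4 * c * (4 / 3) ^ t)\<^sup>2"
      using c \<epsilon>(1) by (intro power_mono) simp_all
    also have "\<dots> = 16 * c\<^sup>2 * (16 / 9) ^ t"
      by (simp add: power_mult_distrib power_divide power_mult[symmetric] mult.commute[of t] power_mult)
    also have "\<dots> \<le> (3 / 2) ^ t / 3 * (16 / 9) ^ t"
      using t0[OF t(2)] by (intro mult_right_mono) simp_all
    also have "\<dots> = (8 / 3) ^ t / 3"
      by (simp add: power_mult_distrib[symmetric])
    also have "\<dots> \<le> (real (q \<epsilon>))\<^sup>2"
      using q by simp
    finally show ?thesis
      by (rule power2_le_imp_le) simp
  qed
  then have "\<forall>\<epsilon>\<in>{0<..<(3 / 4) ^ t0 / 3}. c * norm (1 / \<epsilon>) \<le> norm (real (q \<epsilon>))"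
    by simp
  moreover have "(0::real) < (3 / 4) ^ t0 / 3"
    by simp
  ultimately show "\<forall>\<^sub>F \<epsilon> in at_right 0. c * norm (1 / \<epsilon>) \<le> norm (real (q \<epsilon>))"
    unfolding eventually_at_right_field by (intro exI[of _ "(3 / 4) ^ t0 / 3"]) auto
qed

theorem theorem4p8:
  shows "one_sided_testable NLTF \<and>
    (\<forall>T q. one_sided_tester_family NLTF T q \<and> (\<forall>\<epsilon>>0. \<forall>n. nonadaptive n (T \<epsilon> n)) \<longrightarrow>
       (\<lambda>\<epsilon>. real (q \<epsilon>)) \<in> \<omega>[at_right 0](\<lambda>\<epsilon>. 1 / \<epsilon>))"
  using NLTF_testable nonadaptive_lower_bound by blast

end
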